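(* There is a universal constant $c>0$ such that the following holds. Consider testing $H_0:\mu=0$ against $H_1:\mu\in K,\ \|\mu\|_2\ge\rho$, where $K\subset\mathbb{R}^d$ is a QCO set, from $N$ samples of $\mathcal N(\mu,\sigma^2\mathbf I_d)$ under the strong $\epsilon$-contamination model. If $$\rho\le c\,\frac{(k_2^\star)^{1/4}\sqrt{\epsilon}\,\sigma}{N^{1/4}},$$ where $k_2^\star=k_2^\star(K,\sigma,N,\epsilon)$ is the second optimal dimension, then no test can simultaneously achieve type-I and type-II errors bounded by $0.1$. Formally, $$\inf_{\phi\in A_s(0.1)}\ \sup_{\mu\in K,\ \|\mu\|_2\ge\rho}\ \sup_{\mathcal C}\ \mathbb{P}_\mu\big(\phi(\mathcal C(\tilde{\mathbf X}))=0\big)\ \ge\ 0.1 .$$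
   Context: QCO set: $K\subset\mathbb{R}^d$ is quadratically convex orthosymmetric if (1) $K$ is convex; (2) $K^2:=\{(\theta_1^2,\dots,\theta_d^2)^\top:\theta\in K\}$ is convex; (3) $\theta\in K$ implies $(\eta_1\theta_1,\dots,\eta_d\theta_d)^\top\in K$ for all $\eta_i\in\{-1,1\}$. Model: $\tilde{\mathbf X}=\{\tilde X_1,\dots,\tilde X_N\}$ are i.i.d. $\mathcal N(\mu,\sigma^2\mathbf I_d)$ with unknown $\mu\in K$ and known $\sigma>0$; $\mathbb{P}_\mu$ is the probability law when the mean is $\mu$. Strong $\epsilon$-contamination: $\epsilon\in[0,c_0)$ is known, with $c_0<1/2$ a fixed small constant. An adversary $\mathcal C$ with full knowledge of the true distribution (and of $K$) inspects $\tilde{\mathbf X}$ and replaces up to $\epsilon N$ of the samples by arbitrary values (possibly randomly); only the resulting $\mathbf X=\mathcal C(\tilde{\mathbf X})$ is observed, and the set of corrupted indices is unknown. A test is a $\{0,1\}$-valued measurable function $\phi$ of the observed data, and $A_s(\alpha)=\{\phi:\sup_{\mathcal C}\mathbb{P}_0(\phi(\mathcal C(\tilde{\mathbf X}))=1)\le\alpha\}$. Kolmogorov $k$-width: $D_k(K)=\inf_{P\in\mathcal P_k}\sup_{\theta\in K}\|\theta-P\theta\|_2$, $\mathcal P_k$ being the set of orthogonal projections of rank $k$ in $\mathbb{R}^d$; $D_k(K)=\infty$ for $k<0$, $D_k(K)=0$ for $k>d$. Second optimal dimension: $k_2^\star=\max\{j:0\le j\le d,\ D_{j-1}(K)>\frac{j^{1/4}\sqrt\epsilon}{N^{1/4}}\sigma\}$.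 Standing assumption of the paper: $D_0(K)=\sup_{\theta\in K}\|\theta\|_2>\sigma/\sqrt N$. *)

theory Defs
  imports "HOL-Probability.Probability" "Jordan_Normal_Form.DL_Rank"
begin

(* Vectors of R^d are elements of carrier_vec d. The dimension is a natural number rather than
   a type, so that a constant can be quantified uniformly over all dimensions. *)

definition vnorm :: "real vec \<Rightarrow> real" where
  "vnorm v = L2_set (vec_index v) {..<dim_vec v}"

definition vec_convex :: "real vec set \<Rightarrow> bool" where
  "vec_convex S \<longleftrightarrow>
     (\<forall>x\<in>S. \<forall>y\<in>S. \<forall>t\<in>{0..1::real}. (1 - t) \<cdot>\<^sub>v x + t \<cdot>\<^sub>v y \<in> S)"

definition QCO :: "nat \<Rightarrow> real vec set \<Rightarrow> bool" where
  "QCO d K \<longleftrightarrow> K \<subseteq> carrier_vec d \<and>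
     vec_convex K \<and>
     vec_convex ((\<lambda>\<theta>. vec d (\<lambda>i. (\<theta> $ i)\<^sup>2)) ` K) \<and>
     (\<forall>\<theta>\<in>K. \<forall>\<eta>::nat \<Rightarrow> real. (\<forall>i<d. \<eta> i \<in> {-1, 1}) \<longrightarrow> vec d (\<lambda>i. \<eta> i * \<theta> $ i) \<in> K)"

definition orth_projections :: "nat \<Rightarrow> nat \<Rightarrow> real mat set" where
  "orth_projections d k =
     {P \<in> carrier_mat d d. P * P = P \<and> transpose_mat P = P \<and> vec_space.rank d P = k}"

(* The index is an integer because k2_star uses the (j-1)-width with j = 0; the value may be
   infinite because K need not be bounded. *)
definition kolmogorov_width :: "nat \<Rightarrow> real vec set \<Rightarrow> int \<Rightarrow> ennreal" where
  "kolmogorov_width d K k =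
     (if k < 0 then \<infinity> else if k > int d then 0
      else (INF P \<in> orth_projections d (nat k). SUP \<theta>\<in>K. ennreal (vnorm (\<theta> - P *\<^sub>v \<theta>))))"

definition k2_star :: "nat \<Rightarrow> real vec set \<Rightarrow> real \<Rightarrow> nat \<Rightarrow> real \<Rightarrow> nat" where
  "k2_star d K \<sigma> N \<epsilon> =
     Max {j \<in> {0..d}. kolmogorov_width d K (int j - 1)
            > ennreal (real j powr (1/4) * sqrt \<epsilon> / real N powr (1/4) * \<sigma>)}"

(* A data set is a function x with x i l the l-th coordinate of the i-th sample (i < N, l < d),
   extensional in both arguments. *)
definition data_space :: "nat \<Rightarrow> nat \<Rightarrow> (nat \<Rightarrow> nat \<Rightarrow> real) measure" where
  "data_space N d = PiM {..<N} (\<lambda>_. PiM {..<d} (\<lambda>_. borel))"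

definition gaussian_vec :: "nat \<Rightarrow> real vec \<Rightarrow> real \<Rightarrow> (nat \<Rightarrow> real) measure" where
  "gaussian_vec d \<mu> \<sigma> = PiM {..<d} (\<lambda>l. density lborel (\<lambda>t. ennreal (normal_density (\<mu> $ l) \<sigma> t)))"

definition gaussian_sample :: "nat \<Rightarrow> nat \<Rightarrow> real vec \<Rightarrow> real \<Rightarrow> (nat \<Rightarrow> nat \<Rightarrow> real) measure" where
  "gaussian_sample N d \<mu> \<sigma> = PiM {..<N} (\<lambda>_. gaussian_vec d \<mu> \<sigma>)"

(* A possibly randomized adversary is a Markov kernel from clean to observed data which almost
   surely changes at most epsilon * N of the samples. *)
definition adversaries ::
  "nat \<Rightarrow> nat \<Rightarrow> real \<Rightarrow> ((nat \<Rightarrow> nat \<Rightarrow> real) \<Rightarrow> (nat \<Rightarrow> nat \<Rightarrow> real) measure) set" where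
  "adversaries N d \<epsilon> =
     {C \<in> data_space N d \<rightarrow>\<^sub>M prob_algebra (data_space N d).
        \<forall>x\<in>space (data_space N d).
          AE y in C x. real (card {i\<in>{..<N}. y i \<noteq> x i}) \<le> \<epsilon> * real N}"

(* The probability that the test returns b on the corrupted data. *)
definition test_prob ::
  "nat \<Rightarrow> nat \<Rightarrow> real \<Rightarrow> real vec \<Rightarrow> ((nat \<Rightarrow> nat \<Rightarrow> real) \<Rightarrow> (nat \<Rightarrow> nat \<Rightarrow> real) measure)
     \<Rightarrow> ((nat \<Rightarrow> nat \<Rightarrow> real) \<Rightarrow> nat) \<Rightarrow> nat \<Rightarrow> ennreal" where
  "test_prob N d \<sigma> \<mu> C \<phi> b =
     emeasure (gaussian_sample N d \<mu> \<sigma> \<bind> C) {x \<in> space (data_space N d). \<phi> x = b}"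

definition level_tests ::
  "nat \<Rightarrow> nat \<Rightarrow> real \<Rightarrow> real \<Rightarrow> real \<Rightarrow> ((nat \<Rightarrow> nat \<Rightarrow> real) \<Rightarrow> nat) set" where
  "level_tests N d \<sigma> \<epsilon> \<alpha> =
     {\<phi> \<in> data_space N d \<rightarrow>\<^sub>M count_space {0, 1}.
        (SUP C\<in>adversaries N d \<epsilon>. test_prob N d \<sigma> (0\<^sub>v d) C \<phi> 1) \<le> ennreal \<alpha>}"

end

theory Submission
  imports Defs
begin

text \<open>
  Write \<open>k\<close> for the second optimal dimension and \<open>r = k\<^sup>1\<^sup>/\<^sup>4 \<surd>\<epsilon> \<sigma> / N\<^sup>1\<^sup>/\<^sup>4\<close>, so that
  \<open>D\<^sub>k\<^sub>-\<^sub>1(K) > r\<close>. As no coordinate projection of rank \<open>k - 1\<close> captures \<open>K\<close> up to \<open>r\<close>, convexity of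
  \<open>K\<^sup>2\<close> yields \<open>v \<in> K\<close> with norm of order \<open>r\<close> whose squared coordinates are all of order at most
  \<open>r\<^sup>2 / k\<close>; hence the sum of the \<open>v\<^sub>l\<^sup>4 / \<sigma>\<^sup>4\<close> is of order \<open>\<epsilon>\<^sup>2 / N\<close>.

  Give the coordinates of \<open>v\<close> independent uniform signs. In the resulting mixture, the conditional law
  of each sample given the previous ones differs from pure noise by a small multiple of \<open>\<epsilon>\<close> in expected
  total variation, which a conditional chi-square computation shows. An adversary who does not know the
  signs processes the samples in order and replaces each one by a maximal coupling with pure noise. The
  output is exactly pure noise, and the expected number of replacements is a small multiple of \<open>\<epsilon> N\<close>,
  so by Markov's inequality the budget suffices with constant probability.
\<close>

unbundle no vec_syntax

section \<open>Spread-out points of QCO sets\<close>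

text \<open>Even with random signs the clean data may be far from noise: over all \<open>N\<close>
  samples the chi-square divergence can be exponential in \<open>N * \<epsilon>\<^sup>2\<close>.
  Indistinguishability must therefore come from the adversary. An adversary aiming at one known mean
  would have to change a fraction of order \<open>vnorm v / \<sigma>\<close> of the samples,
  possibly far above \<epsilon>. With the signs averaged out, the first-order term of the likelihood
  ratio disappears, and what remains is the information that the past carries about the signs. Fewer
  than \<open>N\<close> samples precede any given one, so its conditional chi-square divergence is
  at most of order \<open>N\<close> times the sum of the
  \<open>v\<^sub>l\<^sup>4 / \<sigma>\<^sup>4\<close>, that is \<open>\<epsilon>\<^sup>2\<close>,
  which corresponds to total variation of order \<epsilon>. A single kernel must serve all sign
  patterns, because the worst type-II error is bounded below by averaging over the signs for a fixed
  adversary.\<close>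

definition coord_proj :: "nat \<Rightarrow> nat set \<Rightarrow> real mat" where
  "coord_proj d S = mat d d (\<lambda>(i, j). if i = j \<and> i \<in> S then 1 else 0)"

lemma coord_proj_carrier [simp]: "coord_proj d S \<in> carrier_mat d d"
  by (simp add: coord_proj_def)

lemma rank_coord_proj_le:
  assumes "finite S"
  shows "vec_space.rank d (coord_proj d S) \<le> card S"
  using assms
proof (induction S rule: finite_induct)
  case empty
  have "coord_proj d {} = 0\<^sub>m d d"
    by (auto simp: coord_proj_def)
  then show ?case
    using vec_space.rank_0I[of d d, where ?'a = real] by simp
next
  case (insert i S)
  have eq: "coord_proj d (insert i S) = coord_proj d S + coord_proj d {i}"
    using insert by (auto simp: coord_proj_def)
  have "vec_space.rank d (coord_proj d {i}) \<le> 1"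
    by (rule vec_space.rank_le_1_product_entries[where nc = d and f = "\<lambda>r. if r = i then 1 else 0"
          and g = "\<lambda>c. if c = i then 1 else 0"])
       (auto simp: coord_proj_def)
  then have "vec_space.rank d (coord_proj d (insert i S)) \<le> card S + 1"
    unfolding eq using insert.IH
      vec_space.rank_subadditive[OF coord_proj_carrier coord_proj_carrier, of d S "{i}"]
    by linarith
  then show ?case
    using insert by simp
qed

text \<open>The lower bound comes from subadditivity: the complementary projection has rank at most
  \<open>d - card S\<close>, and the two add up to the identity.\<close>

lemma rank_coord_proj:
  assumes S: "S \<subseteq> {..<d}"
  shows "vec_space.rank d (coord_proj d S) = card S"
proof -
  have fin: "finite S" using S finite_subset by blast
  have eq: "coord_proj d S + coord_proj d ({..<d} - S) = 1\<^sub>m d"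
    by (auto simp: coord_proj_def)
  have "vec_space.rank d (1\<^sub>m d :: real mat) = d"
    by (rule vec_space.low_rank_det_zero) auto
  then have "d \<le> vec_space.rank d (coord_proj d S) + vec_space.rank d (coord_proj d ({..<d} - S))"
    using vec_space.rank_subadditive[OF coord_proj_carrier coord_proj_carrier, of d S "{..<d} - S"]
    by (simp add: eq)
  moreover have "vec_space.rank d (coord_proj d ({..<d} - S)) \<le> d - card S"
    using rank_coord_proj_le[of "{..<d} - S" d] S fin by (simp add: card_Diff_subset)
  moreover have "card S \<le> d"
    using card_mono[OF _ S] by simp
  ultimately show ?thesis
    using rank_coord_proj_le[OF fin, of d] by linarith
qed

lemma coord_proj_in_orth_projections:
  assumes S: "S \<subseteq> {..<d}"
  shows "coord_proj d S \<in> orth_projections d (card S)"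
proof -
  have "coord_proj d S * coord_proj d S = coord_proj d S"
  proof (rule eq_matI)
    fix i j
    assume "i < dim_row (coord_proj d S)" "j < dim_col (coord_proj d S)"
    then have ij: "i < d" "j < d" by (auto simp: coord_proj_def)
    have "(coord_proj d S * coord_proj d S) $$ (i, j)
        = (\<Sum>l\<in>{0..<d}. (if i = l \<and> i \<in> S then 1 else 0) * (if l = j \<and> l \<in> S then 1 else 0))"
      using ij by (simp add: coord_proj_def scalar_prod_def)
    also have "\<dots> = (\<Sum>l\<in>{0..<d}. if l = i then (if i = j \<and> i \<in> S then 1 else 0) else 0)"
      by (intro sum.cong) auto
    also have "\<dots> = coord_proj d S $$ (i, j)"
      using ij by (simp add: coord_proj_def)
    finally show "(coord_proj d S * coord_proj d S) $$ (i, j) = coord_proj d S $$ (i, j)" .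
  qed (simp_all add: coord_proj_def)
  moreover have "transpose_mat (coord_proj d S) = coord_proj d S"
    by (auto simp: coord_proj_def)
  ultimately show ?thesis
    using rank_coord_proj[OF S] by (simp add: orth_projections_def)
qed

lemma vnorm_coord_proj_residual:
  assumes "\<theta> \<in> carrier_vec d" "S \<subseteq> {..<d}"
  shows "vnorm (\<theta> - coord_proj d S *\<^sub>v \<theta>) = sqrt (\<Sum>i\<in>{..<d} - S. (\<theta> $ i)\<^sup>2)"
proof -
  have entry: "(coord_proj d S *\<^sub>v \<theta>) $ i = (if i \<in> S then \<theta> $ i else 0)" if "i < d" for i
  proof -
    have "(coord_proj d S *\<^sub>v \<theta>) $ i = (\<Sum>l\<in>{0..<d}. (if i = l \<and> i \<in> S then 1 else 0) * \<theta> $ l)"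
      using that assms by (simp add: coord_proj_def scalar_prod_def)
    also have "\<dots> = (\<Sum>l\<in>{0..<d}. if l = i then (if i \<in> S then \<theta> $ i else 0) else 0)"
      by (intro sum.cong) auto
    finally show ?thesis using that by simp
  qed
  have dim: "dim_vec (\<theta> - coord_proj d S *\<^sub>v \<theta>) = d"
    by (simp add: coord_proj_def)
  have "(\<Sum>i<d. ((\<theta> - coord_proj d S *\<^sub>v \<theta>) $ i)\<^sup>2) = (\<Sum>i<d. if i \<in> S then 0 else (\<theta> $ i)\<^sup>2)"
    using assms entry by (intro sum.cong) (auto simp: coord_proj_def)
  also have "\<dots> = (\<Sum>i\<in>{..<d} - S. (\<theta> $ i)\<^sup>2)"
    by (intro sum.mono_neutral_cong_right) auto
  finally show ?thesis
    unfolding vnorm_def L2_set_def dim by simp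
qed

text \<open>Coordinate projections compete in the infimum that defines the width, so fewer than
  \<open>k\<close> coordinates cannot capture \<open>K\<close> up to \<open>r\<close>.\<close>

lemma kolmogorov_width_tail:
  assumes K: "K \<subseteq> carrier_vec d"
    and width: "kolmogorov_width d K (int k - 1) > ennreal r" and r: "0 \<le> r"
    and k: "k \<le> d" and S: "S \<subseteq> {..<d}" "card S < k"
  obtains \<theta> where "\<theta> \<in> K" "(\<Sum>i\<in>{..<d} - S. (\<theta> $ i)\<^sup>2) > r\<^sup>2"
proof -
  have "card S \<le> k - 1" "k - 1 \<le> card {..<d}" using S k by auto
  \<comment> \<open>The width ranges over projections of rank exactly \<open>k - 1\<close>, so
    \<open>S\<close> is enlarged to that size; this only shrinks the tail.\<close>
  then obtain T where T: "S \<subseteq> T" "T \<subseteq> {..<d}" "card T = k - 1"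
    using exists_subset_between[of S "k - 1" "{..<d}"] S by auto
  have "kolmogorov_width d K (int k - 1)
      = (INF P \<in> orth_projections d (k - 1). SUP \<theta>\<in>K. ennreal (vnorm (\<theta> - P *\<^sub>v \<theta>)))"
    using S k by (auto simp: kolmogorov_width_def nat_diff_distrib)
  also have "\<dots> \<le> (SUP \<theta>\<in>K. ennreal (vnorm (\<theta> - coord_proj d T *\<^sub>v \<theta>)))"
    using coord_proj_in_orth_projections[OF T(2)] T(3) by (intro INF_lower) simp
  finally have "ennreal r < (SUP \<theta>\<in>K. ennreal (vnorm (\<theta> - coord_proj d T *\<^sub>v \<theta>)))"
    using width by order
  then obtain \<theta> where \<theta>: "\<theta> \<in> K" "ennreal r < ennreal (vnorm (\<theta> - coord_proj d T *\<^sub>v \<theta>))"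
    by (auto simp: less_SUP_iff)
  then have "r < sqrt (\<Sum>i\<in>{..<d} - T. (\<theta> $ i)\<^sup>2)"
    using K r T(2) by (subst (asm) vnorm_coord_proj_residual) (auto simp: ennreal_less_iff)
  then have "r\<^sup>2 < (\<Sum>i\<in>{..<d} - T. (\<theta> $ i)\<^sup>2)"
    using power_strict_mono[OF _ r, of _ 2] by (fastforce simp: sum_nonneg)
  also have "\<dots> \<le> (\<Sum>i\<in>{..<d} - S. (\<theta> $ i)\<^sup>2)"
    using T by (intro sum_mono2) auto
  finally show ?thesis
    using that \<theta>(1) by blast
qed

text \<open>Multiplying one coordinate by a number in \<open>[-1, 1]\<close> is a convex combination
  of a point and its reflection in that coordinate; the induction treats the coordinates one at a
  time.\<close>

lemma QCO_shrink:
  assumes K: "QCO d K" and \<theta>: "\<theta> \<in> K" and a: "\<And>i. i < d \<Longrightarrow> \<bar>a i\<bar> \<le> (1::real)"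
  shows "vec d (\<lambda>i. a i * \<theta> $ i) \<in> K"
proof -
  have sub: "K \<subseteq> carrier_vec d" and conv: "vec_convex K"
    and flip: "\<And>\<theta> \<eta>. \<theta> \<in> K \<Longrightarrow> (\<forall>i<d. \<eta> i \<in> {-1, 1}) \<Longrightarrow> vec d (\<lambda>i. \<eta> i * \<theta> $ i) \<in> K"
    using K by (auto simp: QCO_def)
  have "vec d (\<lambda>i. (if i < n then a i else 1) * \<theta> $ i) \<in> K" for n
  proof (induction n)
    case 0
    have "vec d (\<lambda>i. (if i < 0 then a i else 1) * \<theta> $ i) = \<theta>"
      using sub \<theta> by (intro eq_vecI) auto
    then show ?case using \<theta> by simp
  next
    case (Suc n)
    define u where "u = vec d (\<lambda>i. (if i < n then a i else 1) * \<theta> $ i)"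
    show ?case
    proof (cases "n < d")
      case False
      then have "vec d (\<lambda>i. (if i < Suc n then a i else 1) * \<theta> $ i) = u"
        by (auto simp: u_def)
      then show ?thesis using Suc by (simp add: u_def)
    next
      case True
      \<comment> \<open>Solves \<open>(1 - t) - t = a n\<close>.\<close>
      define t where "t = (1 - a n) / 2"
      define u' where "u' = vec d (\<lambda>i. (if i = n then - 1 else 1) * u $ i)"
      have u: "u \<in> K" using Suc by (simp add: u_def)
      have u': "u' \<in> K" unfolding u'_def by (rule flip[OF u]) auto
      have "t \<in> {0..1}" using a[OF True] by (auto simp: t_def)
      then have "(1 - t) \<cdot>\<^sub>v u + t \<cdot>\<^sub>v u' \<in> K"
        using conv u u' by (auto simp: vec_convex_def)
      moreover have "(1 - t) \<cdot>\<^sub>v u + t \<cdot>\<^sub>v u' = vec d (\<lambda>i. (if i < Suc n then a i else 1) * \<theta> $ i)"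
        by (rule eq_vecI) (auto simp: u_def u'_def t_def field_simps less_Suc_eq)
      ultimately show ?thesis by simp
    qed
  qed
  from this[of d] have "vec d (\<lambda>i. (if i < d then a i else 1) * \<theta> $ i) \<in> K" .
  moreover have "vec d (\<lambda>i. (if i < d then a i else 1) * \<theta> $ i) = vec d (\<lambda>i. a i * \<theta> $ i)"
    by auto
  ultimately show ?thesis by simp
qed

lemma QCO_square_convex:
  assumes K: "QCO d K" and "\<theta> \<in> K" "\<xi> \<in> K" and t: "0 \<le> t" "t \<le> 1"
  obtains \<zeta> where "\<zeta> \<in> K" "\<And>i. i < d \<Longrightarrow> (\<zeta> $ i)\<^sup>2 = (1 - t) * (\<theta> $ i)\<^sup>2 + t * (\<xi> $ i)\<^sup>2"
proof -
  let ?sq = "\<lambda>\<theta>. vec d (\<lambda>i. (\<theta> $ i)\<^sup>2)"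
  have "vec_convex (?sq ` K)" using K by (simp add: QCO_def)
  then have "(1 - t) \<cdot>\<^sub>v ?sq \<theta> + t \<cdot>\<^sub>v ?sq \<xi> \<in> ?sq ` K"
    using assms by (auto simp: vec_convex_def)
  then obtain \<zeta> where \<zeta>: "\<zeta> \<in> K" "(1 - t) \<cdot>\<^sub>v ?sq \<theta> + t \<cdot>\<^sub>v ?sq \<xi> = ?sq \<zeta>"
    by auto
  have "(\<zeta> $ i)\<^sup>2 = (1 - t) * (\<theta> $ i)\<^sup>2 + t * (\<xi> $ i)\<^sup>2" if "i < d" for i
    using arg_cong[OF \<zeta>(2), of "\<lambda>v. v $ i"] that by simp
  with \<zeta>(1) show ?thesis using that by blast
qed

text \<open>Half the harmonic mean of \<open>x\<close> and \<open>t\<close>: a concave surrogate for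
  their minimum, within a factor 2 of it. Being strictly increasing, it still rewards mass added to
  a coordinate just below \<open>t\<close>, where the minimum already saturates.\<close>

definition soft_cap :: "real \<Rightarrow> real \<Rightarrow> real" where
  "soft_cap t x = x * t / (x + t)"

lemma soft_cap_bounds:
  assumes "0 < t" "0 \<le> x"
  shows "0 \<le> soft_cap t x" "soft_cap t x \<le> x" "soft_cap t x \<le> t" "t \<le> x \<Longrightarrow> t / 2 \<le> soft_cap t x"
  using assms by (auto simp: soft_cap_def divide_simps algebra_simps)

text \<open>Both claims compare with \<open>p = (1 - s) * x\<close>, first by concavity and then by
  monotonicity. Below the cap the added \<open>h\<close> is gained at rate
  \<open>t * t / ((p + t) * (p + h + t))\<close>, at least 1/6 since the denominator is at most
  \<open>(2 * t) * (3 * t)\<close>.\<close>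

lemma soft_cap_mix:
  assumes t: "0 < t" and x: "0 \<le> x" and y: "0 \<le> y" and s: "0 \<le> s" "s \<le> 1"
  shows "(1 - s) * soft_cap t x \<le> soft_cap t ((1 - s) * x + s * y)"
    and "x < t \<Longrightarrow> s * y \<le> t \<Longrightarrow> (1 - s) * soft_cap t x + s * y / 6 \<le> soft_cap t ((1 - s) * x + s * y)"
proof -
  define p where "p = (1 - s) * x"
  define h where "h = s * y"
  have p: "0 \<le> p" "p \<le> x" and h: "0 \<le> h"
    using assms by (auto simp: p_def h_def mult_left_le_one_le)
  have "(1 - s) * soft_cap t x = p * t / (x + t)"
    by (simp add: soft_cap_def p_def)
  also have "\<dots> \<le> p * t / (p + t)"
    using p t by (intro divide_left_mono) auto
  finally have 1: "(1 - s) * soft_cap t x \<le> soft_cap t p"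
    by (simp add: soft_cap_def)
  have 2: "soft_cap t (p + h) - soft_cap t p = t * t * h / ((p + t) * (p + h + t))"
    using p h t by (simp add: soft_cap_def divide_simps) (simp add: algebra_simps)
  have "0 \<le> t * t * h / ((p + t) * (p + h + t))"
    using p h t by simp
  with 1 2 show "(1 - s) * soft_cap t x \<le> soft_cap t ((1 - s) * x + s * y)"
    by (simp add: p_def h_def)
  assume "x < t" "s * y \<le> t"
  then have "(p + t) * (p + h + t) \<le> (2 * t) * (3 * t)"
    using p h t by (intro mult_mono) (auto simp: h_def)
  then have "t * t * h / ((2 * t) * (3 * t)) \<le> t * t * h / ((p + t) * (p + h + t))"
    using p h t by (intro divide_left_mono) auto
  then have "h / 6 \<le> soft_cap t (p + h) - soft_cap t p"
    using t by (simp add: 2)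
  with 1 show "(1 - s) * soft_cap t x + s * y / 6 \<le> soft_cap t ((1 - s) * x + s * y)"
    by (simp add: p_def h_def)
qed

text \<open>
  A near-maximiser of the concave function \<open>\<Sum>\<^sub>i soft_cap t (\<theta>\<^sub>i\<^sup>2)\<close> works: if the value is small, then
  fewer than \<open>k\<close> coordinates are large, a tail of some other point of \<open>K\<close> is large off these coordinates,
  and moving towards it inside \<open>K\<^sup>2\<close> increases the function by a fixed amount.
\<close>
lemma QCO_spread_soft:
  assumes K: "QCO d K" "K \<noteq> {}" and k: "1 \<le> k" "k \<le> d" and r: "0 < r"
    and width: "kolmogorov_width d K (int k - 1) > ennreal r"
  shows "\<exists>\<theta>\<in>K. (\<Sum>i<d. soft_cap (r\<^sup>2 / k) ((\<theta> $ i)\<^sup>2)) > r\<^sup>2 / 12"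
proof (rule ccontr)
  define t where "t = r\<^sup>2 / k"
  define \<Phi> where "\<Phi> \<theta> = (\<Sum>i<d. soft_cap t ((\<theta> $ i)\<^sup>2))" for \<theta>
  define B where "B = Sup (\<Phi> ` K)"
  \<comment> \<open>With step \<open>1 / k\<close>, a tail of total mass \<open>r\<^sup>2\<close>
    adds at most \<open>t\<close> to any coordinate.\<close>
  define s where "s = 1 / real k"
  assume "\<not> (\<exists>\<theta>\<in>K. (\<Sum>i<d. soft_cap (r\<^sup>2 / k) ((\<theta> $ i)\<^sup>2)) > r\<^sup>2 / 12)"
  then have le: "\<Phi> \<theta> \<le> r\<^sup>2 / 12" if "\<theta> \<in> K" for \<theta>
    using that by (auto simp: \<Phi>_def t_def not_less)
  have t: "0 < t" and s: "0 < s" "s \<le> 1" using k r by (auto simp: t_def s_def)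
  have bdd: "bdd_above (\<Phi> ` K)" by (rule bdd_aboveI2[OF le])
  \<comment> \<open>The supremum need not be attained, as \<open>K\<close> is not assumed closed.
    The slack is half of the gain \<open>s * r\<^sup>2 / 6\<close> of the move below; the other half
    pays for the loss \<open>s * \<Phi> \<theta>\<close>.\<close>
  have "B - s * r\<^sup>2 / 12 < B" using s r by simp
  then obtain \<theta> where \<theta>: "\<theta> \<in> K" "B - s * r\<^sup>2 / 12 < \<Phi> \<theta>"
    using K bdd unfolding B_def by (metis (no_types, lifting) less_cSUP_iff)
  define S where "S = {i. i < d \<and> t \<le> (\<theta> $ i)\<^sup>2}"
  have S: "S \<subseteq> {..<d}" "finite S" by (auto simp: S_def)
  have "card S * (t / 2) = (\<Sum>i\<in>S. t / 2)" by simp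
  also have "\<dots> \<le> (\<Sum>i\<in>S. soft_cap t ((\<theta> $ i)\<^sup>2))"
    using t by (intro sum_mono soft_cap_bounds) (auto simp: S_def)
  also have "\<dots> \<le> \<Phi> \<theta>"
    unfolding \<Phi>_def using S t by (intro sum_mono2 soft_cap_bounds) auto
  also have "\<dots> \<le> r\<^sup>2 / 12" by (rule le[OF \<theta>(1)])
  also have "\<dots> < k * (t / 2)" using k r by (simp add: t_def)
  finally have "card S < k" using t by simp
  then obtain \<xi> where \<xi>: "\<xi> \<in> K" "(\<Sum>i\<in>{..<d} - S. (\<xi> $ i)\<^sup>2) > r\<^sup>2"
    using kolmogorov_width_tail[of K d r k S] width k S r K by (auto simp: QCO_def)
  define Y where "Y = (\<Sum>i\<in>{..<d} - S. (\<xi> $ i)\<^sup>2)"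
  have Y: "r\<^sup>2 < Y" "0 < Y" using \<xi>(2) r by (auto simp: Y_def intro: le_less_trans[OF zero_le_power2])
  have rY: "0 \<le> r\<^sup>2 / Y" "r\<^sup>2 / Y \<le> 1" using Y by auto
  \<comment> \<open>Rescaled so that the mass off \<open>S\<close> is exactly
    \<open>r\<^sup>2\<close>; a larger mass could violate the requirement
    \<open>s * y \<le> t\<close> of \<open>soft_cap_mix\<close>.\<close>
  define \<zeta> where "\<zeta> = vec d (\<lambda>i. sqrt (r\<^sup>2 / Y) * \<xi> $ i)"
  have \<zeta>: "\<zeta> \<in> K"
    unfolding \<zeta>_def using \<xi>(1) rY by (intro QCO_shrink[OF K(1)]) (auto simp del: real_sqrt_divide)
  have \<zeta>i: "(\<zeta> $ i)\<^sup>2 = (r\<^sup>2 / Y) * (\<xi> $ i)\<^sup>2" if "i < d" for i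
    using that rY by (simp add: \<zeta>_def power_mult_distrib del: real_sqrt_divide)
  have "(\<Sum>i\<in>{..<d} - S. (\<zeta> $ i)\<^sup>2) = (\<Sum>i\<in>{..<d} - S. (r\<^sup>2 / Y) * (\<xi> $ i)\<^sup>2)"
    by (intro sum.cong) (auto simp: \<zeta>i)
  also have "\<dots> = r\<^sup>2" unfolding sum_distrib_left[symmetric] Y_def[symmetric] using Y(2) by simp
  finally have \<zeta>sum: "(\<Sum>i\<in>{..<d} - S. (\<zeta> $ i)\<^sup>2) = r\<^sup>2" .
  obtain \<omega> where \<omega>: "\<omega> \<in> K" "\<And>i. i < d \<Longrightarrow> (\<omega> $ i)\<^sup>2 = (1 - s) * (\<theta> $ i)\<^sup>2 + s * (\<zeta> $ i)\<^sup>2"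
    using QCO_square_convex[OF K(1) \<theta>(1) \<zeta>, of s] s by auto
  have step: "(1 - s) * soft_cap t ((\<theta> $ i)\<^sup>2) + (if i \<in> S then 0 else s * (\<zeta> $ i)\<^sup>2 / 6)
      \<le> soft_cap t ((\<omega> $ i)\<^sup>2)" if i: "i < d" for i
  proof (cases "i \<in> S")
    case True
    then show ?thesis
      using soft_cap_mix(1)[of t "(\<theta> $ i)\<^sup>2" "(\<zeta> $ i)\<^sup>2" s] t s by (simp add: \<omega>(2)[OF i])
  next
    case False
    have "(\<zeta> $ i)\<^sup>2 \<le> (\<Sum>i\<in>{..<d} - S. (\<zeta> $ i)\<^sup>2)"
      using False i by (intro member_le_sum) auto
    then have "s * (\<zeta> $ i)\<^sup>2 \<le> t"
      using k by (simp add: \<zeta>sum s_def t_def divide_right_mono)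
    then show ?thesis
      using soft_cap_mix(2)[of t "(\<theta> $ i)\<^sup>2" "(\<zeta> $ i)\<^sup>2" s] t s False i
      by (simp add: \<omega>(2)[OF i] S_def)
  qed
  have "(1 - s) * \<Phi> \<theta> + s * r\<^sup>2 / 6
      = (\<Sum>i<d. (1 - s) * soft_cap t ((\<theta> $ i)\<^sup>2)) + (\<Sum>i\<in>{..<d} - S. s * (\<zeta> $ i)\<^sup>2 / 6)"
    by (simp add: \<Phi>_def sum_distrib_left flip: sum_divide_distrib \<zeta>sum)
  also have "(\<Sum>i\<in>{..<d} - S. s * (\<zeta> $ i)\<^sup>2 / 6) = (\<Sum>i<d. if i \<in> S then 0 else s * (\<zeta> $ i)\<^sup>2 / 6)"
    by (intro sum.mono_neutral_cong_left) auto
  also have "(\<Sum>i<d. (1 - s) * soft_cap t ((\<theta> $ i)\<^sup>2)) + \<dots> \<le> \<Phi> \<omega>"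
    unfolding \<Phi>_def sum.distrib[symmetric] by (intro sum_mono step) auto
  also have "\<Phi> \<omega> \<le> B"
    unfolding B_def by (intro cSUP_upper \<omega> bdd)
  finally have "(1 - s) * \<Phi> \<theta> + s * r\<^sup>2 / 6 \<le> B" .
  moreover have "s * \<Phi> \<theta> \<le> s * (r\<^sup>2 / 12)"
    using s le[OF \<theta>(1)] by (intro mult_left_mono) auto
  ultimately show False
    using \<theta>(2) by (simp add: algebra_simps)
qed

text \<open>Soft capping the squared coordinates and normalising their sum is itself a
  coordinatewise shrinkage, so it stays in \<open>K\<close>. The shrink factors are at most 1
  because the capped mass exceeds \<open>r\<^sup>2 / 12\<close> and \<open>c \<le> 1/4\<close> gives
  \<open>12 * c\<^sup>2 \<le> 1\<close>.\<close>

lemma QCO_spread: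
  assumes K: "QCO d K" "K \<noteq> {}" and k: "1 \<le> k" "k \<le> d" and r: "0 < r"
    and width: "kolmogorov_width d K (int k - 1) > ennreal r" and c: "0 \<le> c" "c \<le> 1/4"
  obtains v where "v \<in> K" "(\<Sum>i<d. (v $ i)\<^sup>2) = (c * r)\<^sup>2"
    "\<And>i. i < d \<Longrightarrow> (v $ i)\<^sup>2 \<le> 12 * c\<^sup>2 * r\<^sup>2 / k"
proof -
  define t where "t = r\<^sup>2 / k"
  have t: "0 < t" using k r by (simp add: t_def)
  obtain \<theta> where \<theta>: "\<theta> \<in> K" "(\<Sum>i<d. soft_cap t ((\<theta> $ i)\<^sup>2)) > r\<^sup>2 / 12"
    using QCO_spread_soft[OF K k r width] by (auto simp: t_def)
  define a where "a = (\<Sum>i<d. soft_cap t ((\<theta> $ i)\<^sup>2))"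
  have a: "r\<^sup>2 / 12 < a" "0 < a" using \<theta>(2) r by (auto simp: a_def intro: le_less_trans[of 0 "r\<^sup>2 / 12"])
  have ca: "(c * r)\<^sup>2 / a \<le> 12 * c\<^sup>2"
  proof -
    have "(c * r)\<^sup>2 = 12 * c\<^sup>2 * (r\<^sup>2 / 12)" by (simp add: power_mult_distrib)
    also have "\<dots> \<le> 12 * c\<^sup>2 * a" using a by (intro mult_left_mono) auto
    finally show ?thesis using a by (simp add: divide_simps)
  qed
  have c12: "12 * c\<^sup>2 \<le> 1"
    using power_mono[OF c(2) c(1), of 2] by (simp add: power2_eq_square)
  define b where "b i = sqrt ((c * r)\<^sup>2 / a * (t / ((\<theta> $ i)\<^sup>2 + t)))" for i
  have nn: "0 \<le> (c * r)\<^sup>2 / a * (t / ((\<theta> $ i)\<^sup>2 + t))" for i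
    using a t by (intro mult_nonneg_nonneg divide_nonneg_nonneg) auto
  define v where "v = vec d (\<lambda>i. b i * \<theta> $ i)"
  have b: "\<bar>b i\<bar> \<le> 1" for i
  proof -
    have "t / ((\<theta> $ i)\<^sup>2 + t) \<le> 1" using t by (simp add: divide_simps add_nonneg_pos)
    moreover have "(c * r)\<^sup>2 / a \<le> 1" using ca c12 by linarith
    ultimately have "(c * r)\<^sup>2 / a * (t / ((\<theta> $ i)\<^sup>2 + t)) \<le> 1 * 1"
      using t a by (intro mult_mono) auto
    then show ?thesis unfolding b_def using nn[of i] by (simp del: real_sqrt_divide)
  qed
  have v: "v \<in> K"
    unfolding v_def by (rule QCO_shrink[OF K(1) \<theta>(1) b])
  have vi: "(v $ i)\<^sup>2 = (c * r)\<^sup>2 / a * soft_cap t ((\<theta> $ i)\<^sup>2)" if "i < d" for i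
    using that nn by (simp add: v_def b_def power_mult_distrib soft_cap_def field_simps)
  have "(\<Sum>i<d. (v $ i)\<^sup>2) = (c * r)\<^sup>2 / a * a"
    by (simp add: vi a_def sum_distrib_left)
  then have "(\<Sum>i<d. (v $ i)\<^sup>2) = (c * r)\<^sup>2" using a by simp
  moreover have "(v $ i)\<^sup>2 \<le> 12 * c\<^sup>2 * r\<^sup>2 / k" if "i < d" for i
  proof -
    have "(v $ i)\<^sup>2 \<le> 12 * c\<^sup>2 * t"
      unfolding vi[OF that] using ca a t soft_cap_bounds by (intro mult_mono) auto
    then show ?thesis by (simp add: t_def)
  qed
  ultimately show ?thesis using that v by blast
qed

section \<open>Sequential coupling with pure noise\<close>

text \<open>Here \<open>g j x\<close> is the conditional density, relative to \<open>q\<close>, of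
  sample \<open>j\<close> given the past. The past is passed as a whole sequence of which, by
  \<open>g_past\<close>, only the entries below \<open>j\<close> matter; one \<open>x\<close> of
  length \<open>n\<close> thus serves every \<open>j \<le> n\<close>.\<close>

locale sequential_density = prob_space q for q :: "'a measure" +
  fixes g :: "nat \<Rightarrow> (nat \<Rightarrow> 'a) \<Rightarrow> 'a \<Rightarrow> real"
  assumes g_meas: "j \<le> n \<Longrightarrow>
      (\<lambda>(x, y). g j x y) \<in> borel_measurable (PiM {..<n} (\<lambda>_. q) \<Otimes>\<^sub>M q)"
    and g_pos: "0 < g j x y"
    and g_int: "j \<le> n \<Longrightarrow> x \<in> space (PiM {..<n} (\<lambda>_. q)) \<Longrightarrow> (\<integral>\<^sup>+ y. ennreal (g j x y) \<partial>q) = 1"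
    and g_past: "j \<le> i \<Longrightarrow> g j (x(i := z)) y = g j x y"
begin

abbreviation Q :: "nat \<Rightarrow> (nat \<Rightarrow> 'a) measure" where
  "Q n \<equiv> PiM {..<n} (\<lambda>_. q)"

abbreviation coin :: "(bool \<times> 'a) measure" where
  "coin \<equiv> count_space UNIV \<Otimes>\<^sub>M q"

abbreviation R :: "nat \<Rightarrow> (nat \<Rightarrow> bool \<times> 'a) measure" where
  "R n \<equiv> PiM {..<n} (\<lambda>_. coin)"

definition lik :: "nat \<Rightarrow> (nat \<Rightarrow> 'a) \<Rightarrow> ennreal" where
  "lik n x = (\<Prod>j<n. ennreal (g j x (x j)))"

text \<open>The acceptance probability of the maximal coupling.\<close>

definition keep :: "nat \<Rightarrow> (nat \<Rightarrow> 'a) \<Rightarrow> 'a \<Rightarrow> real" where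
  "keep j x y = min 1 (1 / g j x y)"

text \<open>Since \<open>ennreal\<close> vanishes on negative numbers, the integrand is the positive part of \<open>g - 1\<close>.\<close>
definition excess :: "nat \<Rightarrow> (nat \<Rightarrow> 'a) \<Rightarrow> ennreal" where
  "excess j x = (\<integral>\<^sup>+ y. ennreal (g j x y - 1) \<partial>q)"

text \<open>The law of a replacement: the normalised positive part of \<open>1 - g\<close>. The
  default 1 only keeps it a probability density, since with zero excess almost every value is
  kept.\<close>

definition residual :: "nat \<Rightarrow> (nat \<Rightarrow> 'a) \<Rightarrow> 'a \<Rightarrow> ennreal" where
  "residual j x z = (if excess j x = 0 then 1 else ennreal (1 - g j x z) / excess j x)"

text \<open>
  The density of the adversary's private randomness, a coin and a replacement value, with respect to
  \<open>coin\<close>. It realises the maximal coupling of \<open>g j x \<cdot> q\<close> and \<open>q\<close>.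
\<close>
definition wt :: "nat \<Rightarrow> (nat \<Rightarrow> 'a) \<Rightarrow> 'a \<Rightarrow> bool \<times> 'a \<Rightarrow> ennreal" where
  "wt j x y s = (if fst s then ennreal (1 - keep j x y) * residual j x (snd s) else ennreal (keep j x y))"

definition wts :: "nat \<Rightarrow> (nat \<Rightarrow> 'a) \<Rightarrow> (nat \<Rightarrow> bool \<times> 'a) \<Rightarrow> ennreal" where
  "wts n x r = (\<Prod>j<n. wt j x (x j) (r j))"

definition corrupt :: "nat \<Rightarrow> (nat \<Rightarrow> 'a) \<Rightarrow> (nat \<Rightarrow> bool \<times> 'a) \<Rightarrow> nat \<Rightarrow> 'a" where
  "corrupt n x r = (\<lambda>j\<in>{..<n}. if fst (r j) then snd (r j) else x j)"

section \<open>Measurability and sigma-finiteness\<close>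

lemma g_measurable:
  assumes "j \<le> n" "X \<in> M \<rightarrow>\<^sub>M Q n" "Y \<in> M \<rightarrow>\<^sub>M q"
  shows "(\<lambda>\<omega>. g j (X \<omega>) (Y \<omega>)) \<in> borel_measurable M"
  using measurable_compose[OF measurable_Pair[OF assms(2,3)] g_meas[OF assms(1)]] by simp

lemma g_measurable_at:
  assumes "j \<le> n" "x \<in> space (Q n)"
  shows "g j x \<in> borel_measurable q"
  by (rule g_measurable[OF assms(1)]) (use assms in auto)

lemma excess_measurable:
  assumes "j \<le> n"
  shows "excess j \<in> borel_measurable (Q n)"
proof -
  note g_measurable[OF assms, measurable (raw)]
  show ?thesis unfolding excess_def[abs_def] by measurable
qed

lemma excess_measurable':
  assumes "j \<le> n" "X \<in> M \<rightarrow>\<^sub>M Q n"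
  shows "(\<lambda>\<omega>. excess j (X \<omega>)) \<in> borel_measurable M"
  using measurable_compose[OF assms(2) excess_measurable[OF assms(1)]] .

lemma wt_measurable:
  assumes "j \<le> n" "X \<in> M \<rightarrow>\<^sub>M Q n" "Y \<in> M \<rightarrow>\<^sub>M q" "S \<in> M \<rightarrow>\<^sub>M coin"
  shows "(\<lambda>\<omega>. wt j (X \<omega>) (Y \<omega>) (S \<omega>)) \<in> borel_measurable M"
proof -
  note g_measurable[OF assms(1), measurable (raw)] excess_measurable'[OF assms(1), measurable (raw)]
    assms(2-4)[measurable]
  show ?thesis unfolding wt_def keep_def residual_def by measurable
qed

lemma component: "j < n \<Longrightarrow> (\<lambda>x. x j) \<in> PiM {..<n} (\<lambda>_. M) \<rightarrow>\<^sub>M M"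
  by (rule measurable_component_singleton) simp

lemma wts_measurable:
  assumes "n \<le> m" "X \<in> M \<rightarrow>\<^sub>M Q m" "Y \<in> M \<rightarrow>\<^sub>M R m"
  shows "(\<lambda>\<omega>. wts n (X \<omega>) (Y \<omega>)) \<in> borel_measurable M"
  unfolding wts_def using assms
  by (intro borel_measurable_prod_ennreal wt_measurable[where n = m] assms)
     (auto intro: measurable_compose[OF _ component])

lemma lik_measurable:
  assumes "n \<le> m"
  shows "lik n \<in> borel_measurable (Q m)"
  unfolding lik_def[abs_def] using assms
  by (intro borel_measurable_prod_ennreal measurable_compose[OF _ measurable_ennreal] g_measurable[where n = m])
     (auto intro: component)

lemma corrupt_measurable:
  assumes "X \<in> M \<rightarrow>\<^sub>M Q n" "Y \<in> M \<rightarrow>\<^sub>M R n"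
  shows "(\<lambda>\<omega>. corrupt n (X \<omega>) (Y \<omega>)) \<in> M \<rightarrow>\<^sub>M Q n"
proof -
  have [measurable]: "(\<lambda>\<omega>. X \<omega> j) \<in> M \<rightarrow>\<^sub>M q" "(\<lambda>\<omega>. Y \<omega> j) \<in> M \<rightarrow>\<^sub>M coin" if "j < n" for j
    using assms that by (auto intro: measurable_compose[OF _ component])
  show ?thesis unfolding corrupt_def by (intro measurable_restrict) simp
qed

lemma sigma_finite_coin: "sigma_finite_measure coin"
  by (intro sigma_finite_pair_measure sigma_finite_measure_count_space_finite)
     (auto simp: sigma_finite_measure_axioms)

lemma product_sigma_finite_Q: "product_sigma_finite (\<lambda>_::nat. q)"
  by (simp add: product_sigma_finite_def sigma_finite_measure_axioms)

lemma product_sigma_finite_R: "product_sigma_finite (\<lambda>_::nat. coin)"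
  by (simp add: product_sigma_finite_def sigma_finite_coin)

lemma sigma_finite_R: "sigma_finite_measure (R n)"
  by (rule product_sigma_finite.sigma_finite[OF product_sigma_finite_R]) simp

section \<open>Maximal coupling of one sample\<close>

lemma nn_integral_coin:
  assumes "f \<in> borel_measurable coin"
  shows "(\<integral>\<^sup>+ s. f s \<partial>coin) = (\<integral>\<^sup>+ z. f (True, z) \<partial>q) + (\<integral>\<^sup>+ z. f (False, z) \<partial>q)"
  unfolding nn_integral_fst[OF assms, symmetric]
  by (simp add: nn_integral_count_space_finite UNIV_bool add.commute)

text \<open>The positive and negative parts of \<open>g - 1\<close> have equal mass because
  \<open>g\<close> has integral 1. Both sides are augmented by 1 and then cancelled, since
  subtraction is truncated in the extended nonnegative reals.\<close>

lemma deficit_eq_excess: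
  assumes "j \<le> n" "x \<in> space (Q n)"
  shows "(\<integral>\<^sup>+ y. ennreal (1 - g j x y) \<partial>q) = excess j x"
proof -
  note g_measurable_at[OF assms, measurable]
  have "1 + (\<integral>\<^sup>+ y. ennreal (1 - g j x y) \<partial>q) = (\<integral>\<^sup>+ y. ennreal (g j x y) + ennreal (1 - g j x y) \<partial>q)"
    by (subst nn_integral_add) (auto simp: g_int[OF assms])
  also have "\<dots> = (\<integral>\<^sup>+ y. 1 + ennreal (g j x y - 1) \<partial>q)"
  proof (intro nn_integral_cong)
    fix y show "ennreal (g j x y) + ennreal (1 - g j x y) = 1 + ennreal (g j x y - 1)"
      using g_pos[of j x y]
      by (cases "g j x y \<le> 1") (auto simp: ennreal_neg ennreal_plus[symmetric] simp flip: ennreal_1 simp del: ennreal_plus)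
  qed
  also have "\<dots> = 1 + excess j x"
    by (subst nn_integral_add) (auto simp: excess_def emeasure_space_1)
  finally show ?thesis
    by (simp add: ennreal_add_left_cancel)
qed

lemma excess_le_1:
  assumes "j \<le> n" "x \<in> space (Q n)"
  shows "excess j x \<le> 1"
  unfolding excess_def using g_pos
  by (subst g_int[OF assms, symmetric], intro nn_integral_mono ennreal_leI) auto

lemma residual_measurable:
  assumes "j \<le> n" "x \<in> space (Q n)"
  shows "residual j x \<in> borel_measurable q"
proof -
  note g_measurable_at[OF assms, measurable]
  show ?thesis unfolding residual_def[abs_def] by measurable
qed

lemma nn_integral_residual:
  assumes "j \<le> n" "x \<in> space (Q n)"
  shows "(\<integral>\<^sup>+ z. residual j x z \<partial>q) = 1"
proof (cases "excess j x = 0")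
  case True
  then show ?thesis by (simp add: residual_def emeasure_space_1)
next
  case False
  note g_measurable_at[OF assms, measurable]
  have "(\<integral>\<^sup>+ z. residual j x z \<partial>q) = excess j x / excess j x"
    using False by (simp add: residual_def nn_integral_divide deficit_eq_excess[OF assms])
  then show ?thesis
    using False excess_le_1[OF assms] by (simp add: ennreal_divide_self less_top[symmetric] top_unique)
       (metis ennreal_divide_self ennreal_one_less_top le_less_trans)
qed

lemma keep_bounds: "0 \<le> keep j x y" "keep j x y \<le> 1"
  using g_pos[of j x y] by (auto simp: keep_def)

lemma keep_times:
  "ennreal (g j x y) * ennreal (keep j x y) = ennreal (min (g j x y) 1)"
  "ennreal (g j x y) * ennreal (1 - keep j x y) = ennreal (g j x y - 1)"
proof -
  have "g j x y * keep j x y = min (g j x y) 1"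
    using g_pos[of j x y] by (auto simp: keep_def min_def divide_simps)
  moreover have "ennreal (g j x y * (1 - keep j x y)) = ennreal (g j x y - 1)"
    using g_pos[of j x y] by (auto simp: keep_def min_def divide_simps ennreal_neg algebra_simps)
  ultimately show "ennreal (g j x y) * ennreal (keep j x y) = ennreal (min (g j x y) 1)"
      "ennreal (g j x y) * ennreal (1 - keep j x y) = ennreal (g j x y - 1)"
    using g_pos[of j x y] keep_bounds[of j x y] by (simp_all flip: ennreal_mult)
qed

lemma nn_integral_wt:
  assumes jn: "j \<le> n" "x \<in> space (Q n)" and y: "y \<in> space q" and [measurable]: "f \<in> borel_measurable q"
  shows "(\<integral>\<^sup>+ s. wt j x y s * f (if fst s then snd s else y) \<partial>coin)
       = ennreal (1 - keep j x y) * (\<integral>\<^sup>+ z. residual j x z * f z \<partial>q) + ennreal (keep j x y) * f y"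
proof -
  note residual_measurable[OF jn, measurable]
  have [measurable]: "wt j x y \<in> borel_measurable coin"
    by (rule wt_measurable[OF jn(1)]) (use assms in auto)
  have meas: "(\<lambda>s. wt j x y s * f (if fst s then snd s else y)) \<in> borel_measurable coin"
    using y by measurable
  show ?thesis
    unfolding nn_integral_coin[OF meas]
    by (simp add: wt_def mult.assoc nn_integral_cmult emeasure_space_1)
qed

lemma nn_integral_wt_total:
  assumes "j \<le> n" "x \<in> space (Q n)" "y \<in> space q"
  shows "(\<integral>\<^sup>+ s. wt j x y s \<partial>coin) = 1"
    and "(\<integral>\<^sup>+ s. wt j x y s * indicator {s. fst s} s \<partial>coin) = ennreal (1 - keep j x y)"
proof -
  note residual_measurable[OF assms(1,2), measurable]
  have [measurable]: "wt j x y \<in> borel_measurable coin"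
    by (rule wt_measurable[OF assms(1)]) (use assms in auto)
  show "(\<integral>\<^sup>+ s. wt j x y s \<partial>coin) = 1"
    using nn_integral_wt[OF assms, of "\<lambda>_. 1"] keep_bounds[of j x y]
    by (simp add: nn_integral_residual[OF assms(1,2)] flip: ennreal_plus)
  show "(\<integral>\<^sup>+ s. wt j x y s * indicator {s. fst s} s \<partial>coin) = ennreal (1 - keep j x y)"
    by (subst nn_integral_coin)
       (auto simp: wt_def nn_integral_cmult nn_integral_residual[OF assms(1,2)])
qed

text \<open>Kept values contribute the overlap \<open>min g 1\<close>, replaced ones redistribute
  the surplus over the deficit \<open>1 - g\<close>, and these add up to density 1. The right-hand
  side is free of \<open>x\<close>: the output is noise whatever the past, so successive outputs are
  independent.\<close>

lemma one_step:
  assumes jn: "j \<le> n" "x \<in> space (Q n)" and f [measurable]: "f \<in> borel_measurable q"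
  shows "(\<integral>\<^sup>+ y. ennreal (g j x y) * (\<integral>\<^sup>+ s. wt j x y s * f (if fst s then snd s else y) \<partial>coin) \<partial>q)
       = (\<integral>\<^sup>+ y. f y \<partial>q)"
proof -
  note residual_measurable[OF jn, measurable] g_measurable_at[OF jn, measurable]
  define I where "I = (\<integral>\<^sup>+ z. residual j x z * f z \<partial>q)"
  have "(\<integral>\<^sup>+ y. ennreal (g j x y) * (\<integral>\<^sup>+ s. wt j x y s * f (if fst s then snd s else y) \<partial>coin) \<partial>q)
      = (\<integral>\<^sup>+ y. ennreal (g j x y - 1) * I + ennreal (min (g j x y) 1) * f y \<partial>q)"
    by (intro nn_integral_cong)
       (simp add: nn_integral_wt[OF jn _ f] I_def distrib_left mult.assoc[symmetric] keep_times)
  also have "\<dots> = excess j x * I + (\<integral>\<^sup>+ y. ennreal (min (g j x y) 1) * f y \<partial>q)"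
    by (subst nn_integral_add) (auto simp: nn_integral_multc excess_def)
  also have "excess j x * I = (\<integral>\<^sup>+ y. ennreal (1 - g j x y) * f y \<partial>q)"
  proof (cases "excess j x = 0")
    \<comment> \<open>With zero excess the deficit vanishes almost everywhere as well, so both sides
      are 0.\<close>
    case True
    then have "AE y in q. ennreal (1 - g j x y) = 0"
      using deficit_eq_excess[OF jn] by (subst nn_integral_0_iff_AE[symmetric]) auto
    then have "(\<integral>\<^sup>+ y. ennreal (1 - g j x y) * f y \<partial>q) = (\<integral>\<^sup>+ y. 0 \<partial>q)"
      by (intro nn_integral_cong_AE) auto
    then show ?thesis using True by simp
  next
    case False
    have fin: "excess j x < \<top>" using excess_le_1[OF jn] by (auto intro: le_less_trans)
    have "excess j x * I = (\<integral>\<^sup>+ y. excess j x * (residual j x y * f y) \<partial>q)"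
      unfolding I_def by (subst nn_integral_cmult) auto
    also have "\<dots> = (\<integral>\<^sup>+ y. ennreal (1 - g j x y) * f y \<partial>q)"
      using False fin
      by (intro nn_integral_cong)
         (simp add: residual_def mult.assoc[symmetric] ennreal_times_divide mult.commute[of "excess j x"]
            ennreal_mult_divide_eq less_top)
    finally show ?thesis .
  qed
  also have "(\<integral>\<^sup>+ y. ennreal (1 - g j x y) * f y \<partial>q) + (\<integral>\<^sup>+ y. ennreal (min (g j x y) 1) * f y \<partial>q)
      = (\<integral>\<^sup>+ y. (ennreal (1 - g j x y) + ennreal (min (g j x y) 1)) * f y \<partial>q)"
    by (subst nn_integral_add[symmetric]) (auto simp: distrib_right)
  also have "\<dots> = (\<integral>\<^sup>+ y. f y \<partial>q)"
  proof (intro nn_integral_cong)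
    fix y
    have "ennreal (1 - g j x y) + ennreal (min (g j x y) 1) = 1"
      using g_pos[of j x y]
      by (cases "g j x y \<le> 1") (auto simp: ennreal_neg simp flip: ennreal_plus)
    then show "(ennreal (1 - g j x y) + ennreal (min (g j x y) 1)) * f y = f y" by simp
  qed
  finally show ?thesis .
qed

section \<open>Coupling of the whole sample\<close>

lemma lik_Suc: "lik (Suc n) (x(n := y)) = lik n x * ennreal (g n x y)"
  unfolding lik_def prod.lessThan_Suc
  by (intro arg_cong2[where f = "(*)"] prod.cong) (auto simp: g_past)

lemma wt_past: "j \<le> i \<Longrightarrow> wt j (x(i := z)) y s = wt j x y s"
  by (simp add: wt_def keep_def residual_def excess_def g_past)

lemma wts_Suc: "wts (Suc n) (x(n := y)) (r(n := s)) = wts n x r * wt n x y s"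
  unfolding wts_def prod.lessThan_Suc
  by (intro arg_cong2[where f = "(*)"] prod.cong) (auto simp: wt_past)

lemma corrupt_Suc:
  "corrupt (Suc n) (x(n := y)) (r(n := s)) = (corrupt n x r)(n := if fst s then snd s else y)"
  by (auto simp: corrupt_def fun_eq_iff less_Suc_eq)


text \<open>The induction peels off the last sample and its coin. It is stated for all
  \<open>f\<close> because \<open>one_step\<close> turns \<open>f\<close> into \<open>F\<close>, its
  average over fresh noise in the last coordinate, and the hypothesis is applied to
  \<open>F\<close>.\<close>

lemma coupling_law:
  assumes "f \<in> borel_measurable (Q n)"
  shows "(\<integral>\<^sup>+ x. lik n x * (\<integral>\<^sup>+ r. wts n x r * f (corrupt n x r) \<partial>R n) \<partial>Q n) = (\<integral>\<^sup>+ x. f x \<partial>Q n)"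
  using assms
proof (induction n arbitrary: f)
  case 0
  show ?case
    by (simp add: PiM_empty nn_integral_count_space_finite lik_def wts_def corrupt_def restrict_def)
next
  case (Suc n)
  interpret PQ: product_sigma_finite "\<lambda>_::nat. q" by (rule product_sigma_finite_Q)
  interpret PR: product_sigma_finite "\<lambda>_::nat. coin" by (rule product_sigma_finite_R)
  interpret RS: sigma_finite_measure "R n" by (rule sigma_finite_R)
  interpret RS': sigma_finite_measure "R (Suc n)" by (rule sigma_finite_R)
  interpret CS: sigma_finite_measure coin by (rule sigma_finite_coin)
  interpret QR: pair_sigma_finite "R n" q ..
  note Suc.prems[measurable]
  note [measurable (raw)] = wts_measurable[of n n] wts_measurable[of "Suc n" "Suc n"]
    corrupt_measurable[of _ _ n] corrupt_measurable[of _ _ "Suc n"]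
    g_measurable[of n n] wt_measurable[of n n]
  note [measurable] = lik_measurable[of "Suc n" "Suc n"] lik_measurable[of n n]
  have upd [measurable (raw)]: "(\<lambda>\<omega>. f ((X \<omega>)(n := Y \<omega>))) \<in> borel_measurable M"
    if "X \<in> M \<rightarrow>\<^sub>M Q n" "Y \<in> M \<rightarrow>\<^sub>M q" for X Y and M :: "'m measure"
    by (rule measurable_compose[OF measurable_fun_upd[OF _ that, of "{..<Suc n}"] Suc.prems])
       (simp add: lessThan_Suc)
  define F where "F u = (\<integral>\<^sup>+ y. f (u(n := y)) \<partial>q)" for u
  have F [measurable]: "F \<in> borel_measurable (Q n)"
    unfolding F_def[abs_def] by measurable
  have m1: "(\<lambda>x. lik (Suc n) x * (\<integral>\<^sup>+ r. wts (Suc n) x r * f (corrupt (Suc n) x r) \<partial>R (Suc n)))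
      \<in> borel_measurable (PiM (insert n {..<n}) (\<lambda>_. q))"
    unfolding lessThan_Suc[symmetric] by measurable
  have inner: "(\<integral>\<^sup>+ y. lik (Suc n) (x(n := y)) *
        (\<integral>\<^sup>+ r. wts (Suc n) (x(n := y)) r * f (corrupt (Suc n) (x(n := y)) r) \<partial>R (Suc n)) \<partial>q)
      = lik n x * (\<integral>\<^sup>+ r. wts n x r * F (corrupt n x r) \<partial>R n)" if x: "x \<in> space (Q n)" for x
  proof -
    have [measurable]: "x \<in> space (Q n)" by (rule x)
    have "(\<integral>\<^sup>+ r. wts (Suc n) (x(n := y)) r * f (corrupt (Suc n) (x(n := y)) r) \<partial>R (Suc n))
        = (\<integral>\<^sup>+ r. wts n x r * (\<integral>\<^sup>+ s. wt n x y s * f ((corrupt n x r)(n := if fst s then snd s else y)) \<partial>coin) \<partial>R n)"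
      if y: "y \<in> space q" for y
    proof -
      have [measurable]: "x(n := y) \<in> space (Q (Suc n))"
        using x y by (auto simp: space_PiM PiE_iff extensional_def)
      have "(\<lambda>r. wts (Suc n) (x(n := y)) r * f (corrupt (Suc n) (x(n := y)) r)) \<in> borel_measurable (R (Suc n))"
        by measurable
      then have "(\<integral>\<^sup>+ r. wts (Suc n) (x(n := y)) r * f (corrupt (Suc n) (x(n := y)) r) \<partial>R (Suc n))
         = (\<integral>\<^sup>+ r. \<integral>\<^sup>+ s. wts (Suc n) (x(n := y)) (r(n := s)) * f (corrupt (Suc n) (x(n := y)) (r(n := s))) \<partial>coin \<partial>R n)"
        unfolding lessThan_Suc by (intro PR.product_nn_integral_insert) auto
      also have "\<dots> = (\<integral>\<^sup>+ r. wts n x r * (\<integral>\<^sup>+ s. wt n x y s * f ((corrupt n x r)(n := if fst s then snd s else y)) \<partial>coin) \<partial>R n)"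
      proof (intro nn_integral_cong)
        fix r assume [measurable]: "r \<in> space (R n)"
        show "(\<integral>\<^sup>+ s. wts (Suc n) (x(n := y)) (r(n := s)) * f (corrupt (Suc n) (x(n := y)) (r(n := s))) \<partial>coin)
            = wts n x r * (\<integral>\<^sup>+ s. wt n x y s * f ((corrupt n x r)(n := if fst s then snd s else y)) \<partial>coin)"
          unfolding wts_Suc corrupt_Suc mult.assoc using y by (intro nn_integral_cmult) measurable
      qed
      finally show ?thesis .
    qed
    then have "(\<integral>\<^sup>+ y. lik (Suc n) (x(n := y)) *
        (\<integral>\<^sup>+ r. wts (Suc n) (x(n := y)) r * f (corrupt (Suc n) (x(n := y)) r) \<partial>R (Suc n)) \<partial>q)
      = (\<integral>\<^sup>+ y. lik n x * (ennreal (g n x y) * (\<integral>\<^sup>+ r. wts n x r *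
          (\<integral>\<^sup>+ s. wt n x y s * f ((corrupt n x r)(n := if fst s then snd s else y)) \<partial>coin) \<partial>R n)) \<partial>q)"
      by (intro nn_integral_cong) (simp add: lik_Suc mult.assoc)
    also have "\<dots> = lik n x * (\<integral>\<^sup>+ y. ennreal (g n x y) * (\<integral>\<^sup>+ r. wts n x r *
          (\<integral>\<^sup>+ s. wt n x y s * f ((corrupt n x r)(n := if fst s then snd s else y)) \<partial>coin) \<partial>R n) \<partial>q)"
      by (intro nn_integral_cmult) measurable
    also have "(\<integral>\<^sup>+ y. ennreal (g n x y) * (\<integral>\<^sup>+ r. wts n x r *
          (\<integral>\<^sup>+ s. wt n x y s * f ((corrupt n x r)(n := if fst s then snd s else y)) \<partial>coin) \<partial>R n) \<partial>q)
        = (\<integral>\<^sup>+ y. \<integral>\<^sup>+ r. ennreal (g n x y) * (wts n x r *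
          (\<integral>\<^sup>+ s. wt n x y s * f ((corrupt n x r)(n := if fst s then snd s else y)) \<partial>coin)) \<partial>R n \<partial>q)"
      by (intro nn_integral_cong nn_integral_cmult[symmetric]) measurable
    \<comment> \<open>The integral over the last sample has to move inside the one over the earlier
      coins, so that \<open>one_step\<close> acts with the corrupted past fixed.\<close>
    also have "\<dots> = (\<integral>\<^sup>+ r. \<integral>\<^sup>+ y. ennreal (g n x y) * (wts n x r *
          (\<integral>\<^sup>+ s. wt n x y s * f ((corrupt n x r)(n := if fst s then snd s else y)) \<partial>coin)) \<partial>q \<partial>R n)"
      by (rule QR.Fubini') measurable
    also have "\<dots> = (\<integral>\<^sup>+ r. wts n x r * (\<integral>\<^sup>+ y. ennreal (g n x y) *
          (\<integral>\<^sup>+ s. wt n x y s * f ((corrupt n x r)(n := if fst s then snd s else y)) \<partial>coin) \<partial>q) \<partial>R n)"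
      by (subst mult.left_commute, intro nn_integral_cong nn_integral_cmult) measurable
    also have "\<dots> = (\<integral>\<^sup>+ r. wts n x r * F (corrupt n x r) \<partial>R n)"
    proof (intro nn_integral_cong)
      fix r assume r [measurable]: "r \<in> space (R n)"
      have "corrupt n x r \<in> space (Q n)"
        by (rule measurable_space[OF corrupt_measurable[of "\<lambda>_. x" "count_space UNIV" n "\<lambda>_. r"], of undefined])
           (use x r in auto)
      then have [measurable]: "(\<lambda>y. f ((corrupt n x r)(n := y))) \<in> borel_measurable q"
        by measurable
      show "wts n x r * (\<integral>\<^sup>+ y. ennreal (g n x y) *
          (\<integral>\<^sup>+ s. wt n x y s * f ((corrupt n x r)(n := if fst s then snd s else y)) \<partial>coin) \<partial>q)
         = wts n x r * F (corrupt n x r)"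
        unfolding F_def by (subst one_step[OF order_refl x]) auto
    qed
    finally show ?thesis .
  qed
  have "(\<integral>\<^sup>+ x. lik (Suc n) x * (\<integral>\<^sup>+ r. wts (Suc n) x r * f (corrupt (Suc n) x r) \<partial>R (Suc n)) \<partial>Q (Suc n))
      = (\<integral>\<^sup>+ x. lik n x * (\<integral>\<^sup>+ r. wts n x r * F (corrupt n x r) \<partial>R n) \<partial>Q n)"
    using PQ.product_nn_integral_insert[OF _ _ m1] inner
    unfolding lessThan_Suc by (simp cong: nn_integral_cong)
  also have "\<dots> = (\<integral>\<^sup>+ x. F x \<partial>Q n)"
    by (rule Suc.IH[OF F])
  also have "\<dots> = (\<integral>\<^sup>+ x. f x \<partial>Q (Suc n))"
    unfolding F_def lessThan_Suc using Suc.prems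
    by (intro PQ.product_nn_integral_insert[symmetric]) (auto simp: lessThan_Suc)
  finally show ?case .
qed

lemma nn_integral_lik_Suc:
  assumes [measurable]: "h \<in> borel_measurable (Q (Suc n))"
  shows "(\<integral>\<^sup>+ x. lik (Suc n) x * h x \<partial>Q (Suc n))
       = (\<integral>\<^sup>+ x. lik n x * (\<integral>\<^sup>+ y. ennreal (g n x y) * h (x(n := y)) \<partial>q) \<partial>Q n)"
proof -
  interpret PQ: product_sigma_finite "\<lambda>_::nat. q" by (rule product_sigma_finite_Q)
  note [measurable] = lik_measurable[of "Suc n" "Suc n"] assms[unfolded lessThan_Suc]
  note [measurable (raw)] = g_measurable[of n n]
  have "(\<lambda>x. lik (Suc n) x * h x) \<in> borel_measurable (Q (Suc n))"
    by measurable
  then have "(\<integral>\<^sup>+ x. lik (Suc n) x * h x \<partial>Q (Suc n))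
     = (\<integral>\<^sup>+ x. \<integral>\<^sup>+ y. lik (Suc n) (x(n := y)) * h (x(n := y)) \<partial>q \<partial>Q n)"
    unfolding lessThan_Suc by (intro PQ.product_nn_integral_insert) auto
  also have "\<dots> = (\<integral>\<^sup>+ x. lik n x * (\<integral>\<^sup>+ y. ennreal (g n x y) * h (x(n := y)) \<partial>q) \<partial>Q n)"
    unfolding lik_Suc mult.assoc
    by (intro nn_integral_cong nn_integral_cmult) measurable
  finally show ?thesis .
qed

lemma nn_integral_lik: "(\<integral>\<^sup>+ x. lik n x \<partial>Q n) = 1"
proof (induction n)
  case 0
  show ?case by (simp add: PiM_empty nn_integral_count_space_finite lik_def)
next
  case (Suc n)
  have "(\<integral>\<^sup>+ x. lik (Suc n) x \<partial>Q (Suc n))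
      = (\<integral>\<^sup>+ x. lik n x * (\<integral>\<^sup>+ y. ennreal (g n x y) * 1 \<partial>q) \<partial>Q n)"
    using nn_integral_lik_Suc[of "\<lambda>_. 1" n] by simp
  also have "\<dots> = (\<integral>\<^sup>+ x. lik n x \<partial>Q n)"
    by (intro nn_integral_cong) (simp add: g_int[OF order_refl])
  finally show ?case using Suc by simp
qed

lemma keep_measurable:
  assumes "m < n"
  shows "(\<lambda>x. keep m x (x m)) \<in> borel_measurable (Q n)"
proof -
  note g_measurable[OF less_imp_le[OF assms], measurable (raw)] component[OF assms, measurable]
  show ?thesis unfolding keep_def by measurable
qed

text \<open>The probability that sample \<open>m\<close> is replaced. Later samples integrate out,
  since \<open>g\<close> has integral 1 and the weight at \<open>m\<close> does not see them; at
  \<open>m\<close> itself \<open>g * (1 - keep)\<close> is the positive part of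
  \<open>g - 1\<close>.\<close>

lemma nn_integral_lik_keep:
  assumes "m < n"
  shows "(\<integral>\<^sup>+ x. lik n x * ennreal (1 - keep m x (x m)) \<partial>Q n) = (\<integral>\<^sup>+ x. lik m x * excess m x \<partial>Q m)"
  using assms
proof (induction n)
  case (Suc n)
  note [measurable] = keep_measurable[OF Suc.prems]
  have "(\<integral>\<^sup>+ x. lik (Suc n) x * ennreal (1 - keep m x (x m)) \<partial>Q (Suc n))
      = (\<integral>\<^sup>+ x. lik n x * (\<integral>\<^sup>+ y. ennreal (g n x y) *
           ennreal (1 - keep m (x(n := y)) ((x(n := y)) m)) \<partial>q) \<partial>Q n)"
    by (intro nn_integral_lik_Suc) measurable
  also have "\<dots> = (\<integral>\<^sup>+ x. lik m x * excess m x \<partial>Q m)"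
  proof (cases "m = n")
    case True
    then show ?thesis
      by (simp add: keep_def g_past keep_times(2)[unfolded keep_def] excess_def)
  next
    case False
    then have m: "m < n" using Suc.prems by simp
    have "(\<integral>\<^sup>+ y. ennreal (g n x y) * ennreal (1 - keep m (x(n := y)) ((x(n := y)) m)) \<partial>q)
        = ennreal (1 - keep m x (x m))" if x: "x \<in> space (Q n)" for x
    proof -
      note g_measurable_at[OF order_refl x, measurable]
      show ?thesis
        using m by (simp add: keep_def g_past nn_integral_multc g_int[OF order_refl x])
    qed
    then show ?thesis
      using Suc.IH[OF m] by (simp cong: nn_integral_cong)
  qed
  finally show ?case .
qed simp

text \<open>The weight of sample \<open>j\<close> reads the clean data only, never the earlier
  coins, so for fixed \<open>x\<close> the integral over \<open>r\<close> factorises.\<close>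

lemma nn_integral_wts:
  assumes x: "x \<in> space (Q n)"
  shows "(\<integral>\<^sup>+ r. wts n x r \<partial>R n) = 1"
    and "m < n \<Longrightarrow> (\<integral>\<^sup>+ r. wts n x r * indicator {s. fst s} (r m) \<partial>R n) = ennreal (1 - keep m x (x m))"
proof -
  interpret PR: product_sigma_finite "\<lambda>_::nat. coin" by (rule product_sigma_finite_R)
  have xj: "x j \<in> space q" if "j < n" for j
    using x that by (auto simp: space_PiM)
  have [measurable]: "wt j x (x j) \<in> borel_measurable coin" if "j < n" for j
    using that x xj by (intro wt_measurable[of j n]) auto
  have "(\<integral>\<^sup>+ r. wts n x r \<partial>R n) = (\<Prod>j<n. \<integral>\<^sup>+ s. wt j x (x j) s \<partial>coin)"
    unfolding wts_def by (rule PR.product_nn_integral_prod) auto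
  then show "(\<integral>\<^sup>+ r. wts n x r \<partial>R n) = 1"
    by (simp add: nn_integral_wt_total(1)[OF _ x xj])
  assume m: "m < n"
  have "(\<integral>\<^sup>+ r. wts n x r * indicator {s. fst s} (r m) \<partial>R n)
     = (\<integral>\<^sup>+ r. (\<Prod>j<n. wt j x (x j) (r j) * (if j = m then indicator {s. fst s} (r j) else 1)) \<partial>R n)"
    using m by (simp add: wts_def prod.distrib)
  also have "\<dots> = (\<Prod>j<n. \<integral>\<^sup>+ s. wt j x (x j) s * (if j = m then indicator {s. fst s} s else 1) \<partial>coin)"
    by (rule PR.product_nn_integral_prod) auto
  also have "\<dots> = (\<Prod>j<n. if j = m then ennreal (1 - keep m x (x m)) else 1)"
    by (intro prod.cong) (auto simp: nn_integral_wt_total[OF _ x xj])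
  also have "\<dots> = ennreal (1 - keep m x (x m))"
    using m by simp
  finally show "(\<integral>\<^sup>+ r. wts n x r * indicator {s. fst s} (r m) \<partial>R n) = ennreal (1 - keep m x (x m))" .
qed


text \<open>The adversary gives up and returns the clean data when the coupling would exceed the budget.\<close>
definition strategy :: "nat \<Rightarrow> real \<Rightarrow> (nat \<Rightarrow> 'a) \<Rightarrow> (nat \<Rightarrow> 'a) measure" where
  "strategy n b x = distr (density (R n) (wts n x)) (Q n)
     (\<lambda>r. if real (card {j\<in>{..<n}. fst (r j)}) \<le> b then corrupt n x r else x)"

lemma real_card_filter:
  "real (card {j\<in>{..<n::nat}. fst (r j)}) = (\<Sum>j<n. indicator {s. fst s} (r j))"
  using sum.inter_filter[OF finite_lessThan[of n], of "\<lambda>_. 1::real" "\<lambda>j. fst (r j)"]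
  by (simp add: indicator_def of_bool_def)

lemma strategy_map_measurable:
  assumes [measurable]: "X \<in> M \<rightarrow>\<^sub>M Q n" "Y \<in> M \<rightarrow>\<^sub>M R n"
  shows "(\<lambda>\<omega>. if real (card {j\<in>{..<n}. fst (Y \<omega> j)}) \<le> b then corrupt n (X \<omega>) (Y \<omega>) else X \<omega>) \<in> M \<rightarrow>\<^sub>M Q n"
proof -
  note [measurable (raw)] = corrupt_measurable[of _ _ n]
  have [measurable]: "(\<lambda>\<omega>. Y \<omega> j) \<in> M \<rightarrow>\<^sub>M coin" if "j < n" for j
    using assms that by (auto intro: measurable_compose[OF _ component])
  show ?thesis unfolding real_card_filter by measurable
qed

lemma strategy_measurable: "strategy n b \<in> Q n \<rightarrow>\<^sub>M prob_algebra (Q n)"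
proof -
  interpret RS: sigma_finite_measure "R n" by (rule sigma_finite_R)
  note [measurable (raw)] = wts_measurable[of n n]
  have prob: "prob_space (density (R n) (wts n x))" if x [measurable]: "x \<in> space (Q n)" for x
  proof (rule prob_spaceI)
    have "emeasure (density (R n) (wts n x)) (space (R n)) = (\<integral>\<^sup>+ r. wts n x r * indicator (space (R n)) r \<partial>R n)"
      by (intro emeasure_density) auto
    also have "\<dots> = (\<integral>\<^sup>+ r. wts n x r \<partial>R n)"
      by (intro nn_integral_cong) simp
    finally show "emeasure (density (R n) (wts n x)) (space (density (R n) (wts n x))) = 1"
      by (simp add: nn_integral_wts(1)[OF x])
  qed
  have "(\<lambda>x. density (R n) (wts n x)) \<in> Q n \<rightarrow>\<^sub>M prob_algebra (R n)"
  proof (intro measurable_prob_algebraI measurable_subprob_algebra prob prob_space_imp_subprob_space)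
    fix A assume [measurable]: "A \<in> sets (R n)"
    have "(\<lambda>x. \<integral>\<^sup>+ r. wts n x r * indicator A r \<partial>R n) \<in> borel_measurable (Q n)"
      by measurable
    also have "?this \<longleftrightarrow> (\<lambda>x. emeasure (density (R n) (wts n x)) A) \<in> borel_measurable (Q n)"
      by (intro measurable_cong emeasure_density[symmetric]) auto
    finally show "(\<lambda>x. emeasure (density (R n) (wts n x)) A) \<in> borel_measurable (Q n)" .
  qed auto
  moreover have "(\<lambda>(x, r). if real (card {j\<in>{..<n}. fst (r j)}) \<le> b then corrupt n x r else x)
      \<in> Q n \<Otimes>\<^sub>M R n \<rightarrow>\<^sub>M Q n"
    unfolding split_beta' by (rule strategy_map_measurable) auto
  ultimately show ?thesis
    unfolding strategy_def[abs_def] by (rule measurable_distr_prob_space2)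
qed

text \<open>Only entries whose coin asks for it are touched, and none after giving up, which fits
  the budget as \<open>b\<close> is nonnegative. Measurable singletons make the event that an entry
  is unchanged measurable.\<close>

lemma strategy_budget:
  assumes single: "\<And>a. a \<in> space q \<Longrightarrow> {a} \<in> sets q" and b: "0 \<le> b" and x: "x \<in> space (Q n)"
  shows "AE y in strategy n b x. real (card {i\<in>{..<n}. y i \<noteq> x i}) \<le> b"
proof -
  have meas: "(\<lambda>r. if real (card {j\<in>{..<n}. fst (r j)}) \<le> b then corrupt n x r else x) \<in> R n \<rightarrow>\<^sub>M Q n"
    by (rule strategy_map_measurable) (use x in auto)
  have "{y \<in> space (Q n). y i = x i} \<in> sets (Q n)" if i: "i < n" for i
  proof -
    have "x i \<in> space q" using x i by (auto simp: space_PiM)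
    then have "(\<lambda>y. y i) -` {x i} \<inter> space (Q n) \<in> sets (Q n)"
      by (intro measurable_sets[OF component[OF i]] single)
    also have "(\<lambda>y. y i) -` {x i} \<inter> space (Q n) = {y \<in> space (Q n). y i = x i}" by auto
    finally show ?thesis .
  qed
  then have [measurable]: "Measurable.pred (Q n) (\<lambda>y. y i = x i)" if "i < n" for i
    using that by (simp add: pred_def)
  have card: "real (card {i\<in>{..<n}. y i \<noteq> x i}) = (\<Sum>i<n. if y i = x i then 0 else 1)" for y
    by (simp add: sum.If_cases Int_def)
  have "{y \<in> space (Q n). real (card {i\<in>{..<n}. y i \<noteq> x i}) \<le> b} \<in> sets (Q n)"
    unfolding card by measurable
  moreover have "real (card {i\<in>{..<n}.
      (if real (card {j\<in>{..<n}. fst (r j)}) \<le> b then corrupt n x r else x) i \<noteq> x i}) \<le> b" for r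
  proof (cases "real (card {j\<in>{..<n}. fst (r j)}) \<le> b")
    case True
    have "card {i\<in>{..<n}. corrupt n x r i \<noteq> x i} \<le> card {j\<in>{..<n}. fst (r j)}"
      by (intro card_mono) (auto simp: corrupt_def split: if_splits)
    then show ?thesis using True by simp
  qed (use b in simp)
  ultimately show ?thesis
    unfolding strategy_def using meas by (subst AE_distr_iff) auto
qed

lemma emeasure_strategy:
  assumes x: "x \<in> space (Q n)" and A: "A \<in> sets (Q n)"
  shows "emeasure (strategy n b x) A = (\<integral>\<^sup>+ r. wts n x r * indicator A
     (if real (card {j\<in>{..<n}. fst (r j)}) \<le> b then corrupt n x r else x) \<partial>R n)"
proof -
  have [measurable]: "(\<lambda>r. if real (card {j\<in>{..<n}. fst (r j)}) \<le> b then corrupt n x r else x) \<in> R n \<rightarrow>\<^sub>M Q n"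
    by (rule strategy_map_measurable) (use x in auto)
  have [measurable]: "wts n x \<in> borel_measurable (R n)"
    by (rule wts_measurable[of n n]) (use x in auto)
  note A [measurable]
  have "emeasure (strategy n b x) A = (\<integral>\<^sup>+ y. indicator A y \<partial>strategy n b x)"
    using A by (simp add: strategy_def)
  also have "\<dots> = (\<integral>\<^sup>+ r. indicator A
     (if real (card {j\<in>{..<n}. fst (r j)}) \<le> b then corrupt n x r else x) \<partial>density (R n) (wts n x))"
    unfolding strategy_def by (rule nn_integral_distr) measurable
  also have "\<dots> = (\<integral>\<^sup>+ r. wts n x r * indicator A
     (if real (card {j\<in>{..<n}. fst (r j)}) \<le> b then corrupt n x r else x) \<partial>R n)"
    by (rule nn_integral_density) measurable
  finally show ?thesis .
qed

text \<open>The untruncated coupling turns the mixture into exact noise, and \<open>strategy\<close>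
  deviates from it only when the coins exceed the budget. The last term is the expected number of
  replacements divided by \<open>b\<close>.\<close>

theorem strategy_simulates:
  assumes A [measurable]: "A \<in> sets (Q n)" and b: "0 < b"
  shows "emeasure (Q n) A \<le> (\<integral>\<^sup>+ x. lik n x * emeasure (strategy n b x) A \<partial>Q n)
     + ennreal (1 / b) * (\<Sum>m<n. \<integral>\<^sup>+ x. lik m x * excess m x \<partial>Q m)"
proof -
  interpret RS: sigma_finite_measure "R n" by (rule sigma_finite_R)
  note [measurable (raw)] = wts_measurable[of n n] corrupt_measurable[of _ _ n]
    strategy_map_measurable[of _ _ n]
  note [measurable] = lik_measurable[of n n] keep_measurable[of _ n] component
  let ?c = "\<lambda>r. if real (card {j\<in>{..<n}. fst (r j)}) \<le> b then 0 else 1::ennreal"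
  let ?s = "\<lambda>r. \<Sum>m<n. indicator {s. fst s} (r m) :: ennreal"
  \<comment> \<open>Markov's inequality in pointwise form: beyond the budget, the count divided by
    \<open>b\<close> is at least 1 and dominates any indicator.\<close>
  have markov: "indicator A (corrupt n x r) \<le> indicator A
      (if real (card {j\<in>{..<n}. fst (r j)}) \<le> b then corrupt n x r else x) + ennreal (1 / b) * ?s r" for x r
  proof (cases "real (card {j\<in>{..<n}. fst (r j)}) \<le> b")
    case False
    have "1 \<le> (1 / b) * real (card {j\<in>{..<n}. fst (r j)})"
      using False b by (simp add: divide_simps)
    then have "1 \<le> ennreal ((1 / b) * (\<Sum>j<n. indicator {s. fst s} (r j)))"
      unfolding real_card_filter by simp
    also have "\<dots> = ennreal (1 / b) * ?s r"
      using b by (subst ennreal_mult) (auto simp: sum_nonneg sum_ennreal[symmetric] ennreal_indicator)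
    finally have "1 \<le> ennreal (1 / b) * ?s r" .
    moreover have "indicator A (corrupt n x r) \<le> (1::ennreal)" by (simp add: indicator_def)
    ultimately show ?thesis by (auto intro: order_trans add_increasing)
  qed simp
  have inner: "(\<integral>\<^sup>+ r. wts n x r * indicator A (corrupt n x r) \<partial>R n)
      \<le> emeasure (strategy n b x) A + ennreal (1 / b) * (\<Sum>m<n. ennreal (1 - keep m x (x m)))"
    if x [measurable]: "x \<in> space (Q n)" for x
  proof -
    have "(\<integral>\<^sup>+ r. wts n x r * indicator A (corrupt n x r) \<partial>R n)
      \<le> (\<integral>\<^sup>+ r. wts n x r * indicator A (if real (card {j\<in>{..<n}. fst (r j)}) \<le> b then corrupt n x r else x)
           + ennreal (1 / b) * (\<Sum>m<n. wts n x r * indicator {s. fst s} (r m)) \<partial>R n)"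
    proof (intro nn_integral_mono)
      fix r
      have "wts n x r * indicator A (corrupt n x r) \<le> wts n x r * (indicator A
          (if real (card {j\<in>{..<n}. fst (r j)}) \<le> b then corrupt n x r else x) + ennreal (1 / b) * ?s r)"
        by (rule mult_left_mono[OF markov]) simp
      also have "\<dots> = wts n x r * indicator A
          (if real (card {j\<in>{..<n}. fst (r j)}) \<le> b then corrupt n x r else x)
          + ennreal (1 / b) * (\<Sum>m<n. wts n x r * indicator {s. fst s} (r m))"
        unfolding distrib_left sum_distrib_left[symmetric] by (simp only: mult.left_commute)
      finally show "wts n x r * indicator A (corrupt n x r) \<le> \<dots>" .
    qed
    also have "\<dots> = (\<integral>\<^sup>+ r. wts n x r * indicator A (if real (card {j\<in>{..<n}. fst (r j)}) \<le> b then corrupt n x r else x) \<partial>R n)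
         + (\<integral>\<^sup>+ r. ennreal (1 / b) * (\<Sum>m<n. wts n x r * indicator {s. fst s} (r m)) \<partial>R n)"
      by (rule nn_integral_add) measurable
    also have "(\<integral>\<^sup>+ r. ennreal (1 / b) * (\<Sum>m<n. wts n x r * indicator {s. fst s} (r m)) \<partial>R n)
        = ennreal (1 / b) * (\<integral>\<^sup>+ r. (\<Sum>m<n. wts n x r * indicator {s. fst s} (r m)) \<partial>R n)"
      by (rule nn_integral_cmult) measurable
    also have "(\<integral>\<^sup>+ r. (\<Sum>m<n. wts n x r * indicator {s. fst s} (r m)) \<partial>R n)
        = (\<Sum>m<n. \<integral>\<^sup>+ r. wts n x r * indicator {s. fst s} (r m) \<partial>R n)"
      by (rule nn_integral_sum) measurable
    also have "\<dots> = (\<Sum>m<n. ennreal (1 - keep m x (x m)))"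
      by (intro sum.cong nn_integral_wts(2)[OF x]) auto
    also note emeasure_strategy[OF x A, symmetric]
    finally show ?thesis .
  qed
  have sm: "strategy n b \<in> Q n \<rightarrow>\<^sub>M subprob_algebra (Q n)"
    by (rule measurable_prob_algebraD[OF strategy_measurable])
  have [measurable]: "(\<lambda>x. emeasure (strategy n b x) A) \<in> borel_measurable (Q n)"
    using emeasure_measurable_subprob_algebra2[OF _ sm, of "\<lambda>_. A"] by simp
  have "emeasure (Q n) A = (\<integral>\<^sup>+ x. lik n x * (\<integral>\<^sup>+ r. wts n x r * indicator A (corrupt n x r) \<partial>R n) \<partial>Q n)"
    by (subst coupling_law) auto
  also have "\<dots> \<le> (\<integral>\<^sup>+ x. lik n x * emeasure (strategy n b x) A
      + ennreal (1 / b) * (\<Sum>m<n. lik n x * ennreal (1 - keep m x (x m))) \<partial>Q n)"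
  proof (intro nn_integral_mono)
    fix x assume "x \<in> space (Q n)"
    then have "lik n x * (\<integral>\<^sup>+ r. wts n x r * indicator A (corrupt n x r) \<partial>R n)
        \<le> lik n x * (emeasure (strategy n b x) A + ennreal (1 / b) * (\<Sum>m<n. ennreal (1 - keep m x (x m))))"
      by (intro mult_left_mono inner) auto
    also have "\<dots> = lik n x * emeasure (strategy n b x) A
        + ennreal (1 / b) * (\<Sum>m<n. lik n x * ennreal (1 - keep m x (x m)))"
      unfolding distrib_left sum_distrib_left[symmetric] by (simp only: mult.left_commute)
    finally show "lik n x * (\<integral>\<^sup>+ r. wts n x r * indicator A (corrupt n x r) \<partial>R n) \<le> \<dots>" .
  qed
  also have "\<dots> = (\<integral>\<^sup>+ x. lik n x * emeasure (strategy n b x) A \<partial>Q n)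
      + (\<integral>\<^sup>+ x. ennreal (1 / b) * (\<Sum>m<n. lik n x * ennreal (1 - keep m x (x m))) \<partial>Q n)"
    by (rule nn_integral_add) measurable
  also have "(\<integral>\<^sup>+ x. ennreal (1 / b) * (\<Sum>m<n. lik n x * ennreal (1 - keep m x (x m))) \<partial>Q n)
      = ennreal (1 / b) * (\<integral>\<^sup>+ x. (\<Sum>m<n. lik n x * ennreal (1 - keep m x (x m))) \<partial>Q n)"
    by (rule nn_integral_cmult) measurable
  also have "(\<integral>\<^sup>+ x. (\<Sum>m<n. lik n x * ennreal (1 - keep m x (x m))) \<partial>Q n)
      = (\<Sum>m<n. \<integral>\<^sup>+ x. lik n x * ennreal (1 - keep m x (x m)) \<partial>Q n)"
    by (rule nn_integral_sum) measurable
  also have "\<dots> = (\<Sum>m<n. \<integral>\<^sup>+ x. lik m x * excess m x \<partial>Q m)"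
    by (intro sum.cong nn_integral_lik_keep) auto
  finally show ?thesis .
qed


text \<open>AM-GM gives \<open>max 0 (u - 1) \<le> l + (u - 1)\<^sup>2 / (4 * l)\<close>. Being
  linear in the second moment, this can be averaged over the past without a square root, with
  \<open>l\<close> left free.\<close>

lemma nn_integral_lik_excess:
  assumes l: "0 < l" and \<delta>: "0 \<le> \<delta>"
    and chi: "(\<integral>\<^sup>+ x. lik j x * (\<integral>\<^sup>+ y. ennreal ((g j x y)\<^sup>2) \<partial>q) \<partial>Q j) \<le> ennreal (1 + \<delta>)"
  shows "(\<integral>\<^sup>+ x. lik j x * excess j x \<partial>Q j) \<le> ennreal (l + \<delta> / (4 * l))"
proof -
  note [measurable (raw)] = g_measurable[of j j] excess_measurable'[of j j]
  note [measurable] = lik_measurable[of j j]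
  \<comment> \<open>The cross term of the square is kept on the left as \<open>1 / (2 * l)\<close>
    to avoid subtraction of extended reals; it is cancelled at the end.\<close>
  have cs: "excess j x + ennreal (1 / (2 * l))
      \<le> ennreal (l + 1 / (4 * l)) + ennreal (1 / (4 * l)) * (\<integral>\<^sup>+ y. ennreal ((g j x y)\<^sup>2) \<partial>q)"
    if x [measurable]: "x \<in> space (Q j)" for x
  proof -
    have "ennreal (g j x y - 1) + ennreal (1 / (2 * l)) * ennreal (g j x y)
        \<le> ennreal (l + 1 / (4 * l)) + ennreal (1 / (4 * l)) * ennreal ((g j x y)\<^sup>2)" for y
    proof -
      define u where "u = g j x y"
      have u: "0 < u" using g_pos by (simp add: u_def)
      have "0 \<le> (2 * l - (u - 1))\<^sup>2 / (4 * l)" "0 \<le> l + (u - 1)\<^sup>2 / (4 * l)" using l by auto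
      moreover have "l + (u - 1)\<^sup>2 / (4 * l) - (u - 1) = (2 * l - (u - 1))\<^sup>2 / (4 * l)"
        using l by (simp add: field_simps power2_eq_square)
      moreover have "(u - 1)\<^sup>2 / (4 * l) = 1 / (4 * l) + 1 / (4 * l) * u\<^sup>2 - 1 / (2 * l) * u"
        using l by (simp add: field_simps power2_eq_square)
      ultimately have "max 0 (u - 1) + 1 / (2 * l) * u \<le> l + 1 / (4 * l) + 1 / (4 * l) * u\<^sup>2"
        by linarith
      then have "ennreal (max 0 (u - 1) + 1 / (2 * l) * u) \<le> ennreal (l + 1 / (4 * l) + 1 / (4 * l) * u\<^sup>2)"
        by (rule ennreal_leI)
      then show ?thesis
        using l u by (simp add: ennreal_plus ennreal_max_0 flip: u_def ennreal_mult)
    qed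
    then have "(\<integral>\<^sup>+ y. ennreal (g j x y - 1) + ennreal (1 / (2 * l)) * ennreal (g j x y) \<partial>q)
        \<le> (\<integral>\<^sup>+ y. ennreal (l + 1 / (4 * l)) + ennreal (1 / (4 * l)) * ennreal ((g j x y)\<^sup>2) \<partial>q)"
      by (intro nn_integral_mono)
    then show ?thesis
      by (simp add: nn_integral_add nn_integral_cmult g_int[OF order_refl x] emeasure_space_1 flip: excess_def)
  qed
  have "(\<integral>\<^sup>+ x. lik j x * excess j x \<partial>Q j) + ennreal (1 / (2 * l))
      = (\<integral>\<^sup>+ x. lik j x * (excess j x + ennreal (1 / (2 * l))) \<partial>Q j)"
    by (simp add: distrib_left nn_integral_add nn_integral_multc nn_integral_lik)
  also have "\<dots> \<le> (\<integral>\<^sup>+ x. lik j x * (ennreal (l + 1 / (4 * l))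
      + ennreal (1 / (4 * l)) * (\<integral>\<^sup>+ y. ennreal ((g j x y)\<^sup>2) \<partial>q)) \<partial>Q j)"
    using cs by (intro nn_integral_mono mult_left_mono) auto
  also have "\<dots> = ennreal (l + 1 / (4 * l))
      + ennreal (1 / (4 * l)) * (\<integral>\<^sup>+ x. lik j x * (\<integral>\<^sup>+ y. ennreal ((g j x y)\<^sup>2) \<partial>q) \<partial>Q j)"
    by (simp add: distrib_left mult.left_commute[of _ "ennreal (1 / (4 * l))"] nn_integral_add
        nn_integral_multc nn_integral_cmult nn_integral_lik)
  also have "\<dots> \<le> ennreal (l + 1 / (4 * l)) + ennreal (1 / (4 * l)) * ennreal (1 + \<delta>)"
    by (intro add_left_mono mult_left_mono chi) simp
  also have "\<dots> = ennreal ((l + \<delta> / (4 * l)) + 1 / (2 * l))"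
    using l \<delta> by (simp add: field_simps flip: ennreal_plus ennreal_mult)
  also have "\<dots> = ennreal (l + \<delta> / (4 * l)) + ennreal (1 / (2 * l))"
    using l \<delta> by (intro ennreal_plus) auto
  finally show ?thesis
    by (simp add: ennreal_add_left_cancel_le add.commute[of _ "ennreal (1 / (2 * l))"])
qed

end

section \<open>Gaussian noise with a random-sign mean\<close>

lemma (in product_sigma_finite) PiM_density:
  assumes I: "finite I" and f [measurable]: "\<And>i. i \<in> I \<Longrightarrow> f i \<in> borel_measurable (M i)"
    and sf: "\<And>i. sigma_finite_measure (density (M i) (f i))"
  shows "PiM I (\<lambda>i. density (M i) (f i)) = density (PiM I M) (\<lambda>x. \<Prod>i\<in>I. f i (x i))"
proof (rule product_sigma_finite.PiM_eqI[symmetric])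
  show "product_sigma_finite (\<lambda>i. density (M i) (f i))"
    using sf by (simp add: product_sigma_finite_def)
  show "finite I" by fact
  show "sets (density (PiM I M) (\<lambda>x. \<Prod>i\<in>I. f i (x i))) = sets (PiM I (\<lambda>i. density (M i) (f i)))"
    unfolding sets_density by (intro sets_PiM_cong) auto
  fix A assume "\<And>i. i \<in> I \<Longrightarrow> A i \<in> sets (density (M i) (f i))"
  then have A [measurable]: "\<And>i. i \<in> I \<Longrightarrow> A i \<in> sets (M i)" by simp
  have [measurable]: "PiE I A \<in> sets (PiM I M)"
    using A I by (intro sets_PiM_I_finite) auto
  have "emeasure (density (PiM I M) (\<lambda>x. \<Prod>i\<in>I. f i (x i))) (PiE I A)
      = (\<integral>\<^sup>+ x. (\<Prod>i\<in>I. f i (x i)) * indicator (PiE I A) x \<partial>PiM I M)"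
    by (intro emeasure_density) (auto intro!: borel_measurable_prod_ennreal)
  also have "\<dots> = (\<integral>\<^sup>+ x. (\<Prod>i\<in>I. f i (x i) * indicator (A i) (x i)) \<partial>PiM I M)"
  proof (intro nn_integral_cong)
    fix x assume x: "x \<in> space (PiM I M)"
    have "indicator (PiE I A) x = (\<Prod>i\<in>I. indicator (A i) (x i) :: ennreal)"
    proof (cases "x \<in> PiE I A")
      case True
      then show ?thesis by (simp add: PiE_iff)
    next
      case False
      then obtain i where "i \<in> I" "x i \<notin> A i" using x by (auto simp: space_PiM PiE_iff)
      then have "(\<Prod>i\<in>I. indicator (A i) (x i) :: ennreal) = 0"
        using I by (intro prod_zero) (auto intro!: bexI[of _ i])
      then show ?thesis using False by simp
    qed
    then show "(\<Prod>i\<in>I. f i (x i)) * indicator (PiE I A) x = (\<Prod>i\<in>I. f i (x i) * indicator (A i) (x i))"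
      by (simp add: prod.distrib)
  qed
  also have "\<dots> = (\<Prod>i\<in>I. \<integral>\<^sup>+ t. f i t * indicator (A i) t \<partial>M i)"
    by (rule product_nn_integral_prod[OF I]) measurable
  also have "\<dots> = (\<Prod>i\<in>I. emeasure (density (M i) (f i)) (A i))"
    by (intro prod.cong refl emeasure_density[symmetric]) auto
  finally show "emeasure (density (PiM I M) (\<lambda>x. \<Prod>i\<in>I. f i (x i))) (PiE I A)
      = (\<Prod>i\<in>I. emeasure (density (M i) (f i)) (A i))" .
qed

text \<open>Completing the square: a shift of the mean is an exponential tilt.\<close>

lemma normal_density_tilt:
  assumes "0 < \<sigma>"
  shows "normal_density 0 \<sigma> t * exp (m / \<sigma>\<^sup>2 * t - m\<^sup>2 / (2 * \<sigma>\<^sup>2)) = normal_density m \<sigma> t"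
proof -
  have "- t\<^sup>2 / (2 * \<sigma>\<^sup>2) + (m / \<sigma>\<^sup>2 * t - m\<^sup>2 / (2 * \<sigma>\<^sup>2)) = - (t - m)\<^sup>2 / (2 * \<sigma>\<^sup>2)"
    using assms by (simp add: field_simps power2_eq_square)
  then show ?thesis
    by (simp add: normal_density_def flip: exp_add)
qed

locale signed_mean =
  fixes d :: nat and \<sigma> :: real and v :: "nat \<Rightarrow> real"
  assumes sigma: "0 < \<sigma>"
begin

definition a :: "nat \<Rightarrow> real" where "a l = v l / \<sigma>\<^sup>2"
text \<open>The squared signal-to-noise ratio of coordinate \<open>l\<close> in one sample.\<close>

definition \<tau> :: "nat \<Rightarrow> real" where "\<tau> l = (v l)\<^sup>2 / \<sigma>\<^sup>2"

abbreviation noise1 :: "real measure" where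
  "noise1 \<equiv> density lborel (\<lambda>t. ennreal (normal_density 0 \<sigma> t))"

abbreviation noise :: "(nat \<Rightarrow> real) measure" where
  "noise \<equiv> PiM {..<d} (\<lambda>_. noise1)"

definition partial_sum :: "nat \<Rightarrow> (nat \<Rightarrow> nat \<Rightarrow> real) \<Rightarrow> nat \<Rightarrow> real" where
  "partial_sum n x l = (\<Sum>i<n. x i l)"

text \<open>
  The conditional density of sample \<open>j\<close> given the previous ones, relative to pure noise, when the mean
  has coordinates \<open>\<plusminus> v l\<close> with independent uniform signs.
\<close>
definition ratio :: "nat \<Rightarrow> (nat \<Rightarrow> nat \<Rightarrow> real) \<Rightarrow> (nat \<Rightarrow> real) \<Rightarrow> real" where
  "ratio j x y = (\<Prod>l<d. exp (- \<tau> l / 2) * cosh (a l * (partial_sum j x l + y l)) / cosh (a l * partial_sum j x l))"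

lemma tau_nonneg: "0 \<le> \<tau> l"
  by (simp add: \<tau>_def)

lemma tau_eq: "(a l)\<^sup>2 * \<sigma>\<^sup>2 = \<tau> l"
  using sigma by (simp add: a_def \<tau>_def power_divide power2_eq_square field_simps)

section \<open>Moments under pure noise\<close>

lemma prob_space_noise1: "prob_space noise1"
  by (rule prob_space_normal_density[OF sigma])

lemma exp_moment:
  "has_bochner_integral noise1 (\<lambda>t. exp (b * t)) (exp (b\<^sup>2 * \<sigma>\<^sup>2 / 2))"
proof -
  have "has_bochner_integral lborel (normal_density (b * \<sigma>\<^sup>2) \<sigma>) 1"
    using sigma by (simp add: has_bochner_integral_iff)
  then have "has_bochner_integral lborel (\<lambda>t. exp (b\<^sup>2 * \<sigma>\<^sup>2 / 2) * normal_density (b * \<sigma>\<^sup>2) \<sigma> t) (exp (b\<^sup>2 * \<sigma>\<^sup>2 / 2) * 1)"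
    by (rule has_bochner_integral_mult_right)
  moreover have "exp (b\<^sup>2 * \<sigma>\<^sup>2 / 2) * normal_density (b * \<sigma>\<^sup>2) \<sigma> t = normal_density 0 \<sigma> t *\<^sub>R exp (b * t)" for t
  proof -
    have eq: "exp (b\<^sup>2 * \<sigma>\<^sup>2 / 2) * exp (b * \<sigma>\<^sup>2 / \<sigma>\<^sup>2 * t - (b * \<sigma>\<^sup>2)\<^sup>2 / (2 * \<sigma>\<^sup>2)) = exp (b * t)"
      unfolding exp_add[symmetric] using sigma by (simp add: field_simps power2_eq_square)
    show ?thesis
      unfolding normal_density_tilt[OF sigma, of t "b * \<sigma>\<^sup>2", symmetric]
      by (simp only: mult.left_commute[of "exp (b\<^sup>2 * \<sigma>\<^sup>2 / 2)"] eq real_scaleR_def)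
  qed
  ultimately show ?thesis
    by (intro has_bochner_integral_density) auto
qed

lemma cosh_moment:
  "has_bochner_integral noise1 (\<lambda>t. cosh (b * (s + t))) (exp (b\<^sup>2 * \<sigma>\<^sup>2 / 2) * cosh (b * s))"
proof -
  have "has_bochner_integral noise1 (\<lambda>t. (exp (b * s) / 2) * exp (b * t) + (exp (- b * s) / 2) * exp ((- b) * t))
     ((exp (b * s) / 2) * exp (b\<^sup>2 * \<sigma>\<^sup>2 / 2) + (exp (- b * s) / 2) * exp ((- b)\<^sup>2 * \<sigma>\<^sup>2 / 2))"
    by (intro has_bochner_integral_add has_bochner_integral_mult_right exp_moment)
  moreover have "(exp (b * s) / 2) * exp (b * t) + (exp (- b * s) / 2) * exp ((- b) * t) = cosh (b * (s + t))" for t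
    by (simp add: cosh_field_def distrib_left exp_add exp_diff exp_minus field_simps)
  moreover have "(exp (b * s) / 2) * exp (b\<^sup>2 * \<sigma>\<^sup>2 / 2) + (exp (- b * s) / 2) * exp ((- b)\<^sup>2 * \<sigma>\<^sup>2 / 2)
     = exp (b\<^sup>2 * \<sigma>\<^sup>2 / 2) * cosh (b * s)"
    by (simp add: cosh_field_def field_simps)
  ultimately show ?thesis by simp
qed

lemma nn_integral_has_bochner:
  assumes "has_bochner_integral M f x" "\<And>t. 0 \<le> f t"
  shows "(\<integral>\<^sup>+ t. ennreal (f t) \<partial>M) = ennreal (x::real)"
  using assms by (subst nn_integral_eq_integral) (auto simp: has_bochner_integral_iff)

lemma ratio_moment1:
  "(\<integral>\<^sup>+ t. ennreal (exp (- \<tau> l / 2) * cosh (a l * (s + t)) / cosh (a l * s)) \<partial>noise1) = 1"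
proof -
  have "has_bochner_integral noise1 (\<lambda>t. (exp (- \<tau> l / 2) / cosh (a l * s)) * cosh (a l * (s + t)))
     ((exp (- \<tau> l / 2) / cosh (a l * s)) * (exp ((a l)\<^sup>2 * \<sigma>\<^sup>2 / 2) * cosh (a l * s)))"
    by (intro has_bochner_integral_mult_right cosh_moment)
  also have "(exp (- \<tau> l / 2) / cosh (a l * s)) * (exp ((a l)\<^sup>2 * \<sigma>\<^sup>2 / 2) * cosh (a l * s)) = 1"
    unfolding tau_eq by (simp add: exp_minus field_simps)
  finally show ?thesis
    by (subst nn_integral_has_bochner[where x = 1]) auto
qed

text \<open>The double-angle formula makes the square affine in a \<open>cosh\<close> of doubled
  frequency. At \<open>s = 0\<close> the value is \<open>cosh (\<tau> l)\<close>, the second moment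
  with an unknown sign; as \<open>a l * s\<close> grows in size it approaches
  \<open>exp (\<tau> l)\<close>, that of a known sign.\<close>

lemma ratio_moment2:
  "(\<integral>\<^sup>+ t. ennreal ((exp (- \<tau> l / 2) * cosh (a l * (s + t)) / cosh (a l * s))\<^sup>2) \<partial>noise1)
     = ennreal (exp (\<tau> l) - sinh (\<tau> l) / (cosh (a l * s))\<^sup>2)"
proof -
  interpret prob_space noise1 by (rule prob_space_noise1)
  let ?C = "cosh (a l * s)"
  let ?p = "exp (- \<tau> l) / (2 * ?C\<^sup>2)"
  have one: "has_bochner_integral noise1 (\<lambda>_. ?p) ?p"
    using prob_space by (simp add: has_bochner_integral_iff)
  have "has_bochner_integral noise1 (\<lambda>t. ?p + ?p * cosh (2 * a l * (s + t)))
     (?p + ?p * (exp ((2 * a l)\<^sup>2 * \<sigma>\<^sup>2 / 2) * cosh (2 * a l * s)))"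
    by (intro has_bochner_integral_add has_bochner_integral_mult_right cosh_moment one)
  moreover have "?p + ?p * cosh (2 * a l * (s + t)) = (exp (- \<tau> l / 2) * cosh (a l * (s + t)) / ?C)\<^sup>2" for t
  proof -
    have "(exp (- \<tau> l / 2))\<^sup>2 = exp (- \<tau> l)" by (simp flip: exp_double)
    moreover have "cosh (2 * a l * (s + t)) = 2 * (cosh (a l * (s + t)))\<^sup>2 - 1"
      using cosh_double_cosh[of "a l * (s + t)"] by (simp add: mult.assoc)
    moreover have "e / (2 * c) + e / (2 * c) * (2 * x - 1) = e * x / c" if "c \<noteq> 0" for c e x :: real
      using that by (simp add: field_simps)
    ultimately show ?thesis
      by (simp only: power_mult_distrib power_divide) simp
  qed
  moreover have "?p + ?p * (exp ((2 * a l)\<^sup>2 * \<sigma>\<^sup>2 / 2) * cosh (2 * a l * s))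
      = exp (\<tau> l) - sinh (\<tau> l) / ?C\<^sup>2"
  proof -
    have "(2 * a l)\<^sup>2 * \<sigma>\<^sup>2 / 2 = 2 * \<tau> l"
      using tau_eq[of l] by (simp add: power_mult_distrib mult.commute)
    moreover have "cosh (2 * a l * s) = 2 * ?C\<^sup>2 - 1"
      using cosh_double_cosh[of "a l * s"] by (simp add: mult.assoc)
    moreover have "e / (2 * c) + e / (2 * c) * (f * (2 * c - 1)) = e * f - ((e * f - e) / 2) / c"
      if "c \<noteq> 0" for c e f :: real
      using that by (simp add: field_simps)
    moreover have "exp (\<tau> l) = exp (- \<tau> l) * exp (2 * \<tau> l)"
      by (simp flip: exp_add)
    moreover have "?C\<^sup>2 \<noteq> 0" by simp
    ultimately show ?thesis
      unfolding sinh_field_def by (simp only: not_False_eq_True simp_thms)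
  qed
  ultimately show ?thesis
    by (subst nn_integral_has_bochner) auto
qed

text \<open>As \<open>cosh\<close> is at least 1, the condition
  \<open>\<beta> \<le> \<alpha>\<close> keeps the integrand nonnegative, so \<open>ennreal\<close>
  truncates nothing.\<close>

lemma affine_cosh_moment:
  assumes "0 \<le> \<beta>" "\<beta> \<le> \<alpha>"
  shows "(\<integral>\<^sup>+ t. ennreal (\<alpha> * cosh (a l * (s + t)) - \<beta>) \<partial>noise1)
     = ennreal (\<alpha> * exp (\<tau> l / 2) * cosh (a l * s) - \<beta>)"
proof -
  interpret prob_space noise1 by (rule prob_space_noise1)
  have one: "has_bochner_integral noise1 (\<lambda>_. \<beta>) \<beta>"
    using prob_space by (simp add: has_bochner_integral_iff)
  have "has_bochner_integral noise1 (\<lambda>t. \<alpha> * cosh (a l * (s + t)) - \<beta>)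
      (\<alpha> * (exp ((a l)\<^sup>2 * \<sigma>\<^sup>2 / 2) * cosh (a l * s)) - \<beta>)"
    by (intro has_bochner_integral_diff has_bochner_integral_mult_right cosh_moment one)
  moreover have "0 \<le> \<alpha> * cosh (a l * (s + t)) - \<beta>" for t
    using assms mult_mono[of \<alpha> \<alpha> 1 "cosh (a l * (s + t))"] cosh_real_ge_1[of "a l * (s + t)"] by simp
  ultimately show ?thesis
    by (subst nn_integral_has_bochner) (auto simp: tau_eq mult.assoc)
qed

lemma prob_space_noise: "prob_space noise"
  by (intro prob_space_PiM prob_space_noise1)

lemma product_sigma_finite_noise1: "product_sigma_finite (\<lambda>_::nat. noise1)"
  by (simp add: product_sigma_finite_def prob_space_imp_sigma_finite prob_space_noise1)

lemma nn_integral_noise_prod: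
  assumes "\<And>l. l < d \<Longrightarrow> f l \<in> borel_measurable borel" "\<And>l t. l < d \<Longrightarrow> 0 \<le> f l t"
  shows "(\<integral>\<^sup>+ y. ennreal (\<Prod>l<d. f l (y l)) \<partial>noise) = (\<Prod>l<d. \<integral>\<^sup>+ t. ennreal (f l t) \<partial>noise1)"
proof -
  have "(\<integral>\<^sup>+ y. ennreal (\<Prod>l<d. f l (y l)) \<partial>noise) = (\<integral>\<^sup>+ y. (\<Prod>l<d. ennreal (f l (y l))) \<partial>noise)"
    by (intro nn_integral_cong prod_ennreal[symmetric]) (simp add: assms(2))
  also have "\<dots> = (\<Prod>l<d. \<integral>\<^sup>+ t. ennreal (f l t) \<partial>noise1)"
    using assms(1)
    by (intro product_sigma_finite.product_nn_integral_prod[OF product_sigma_finite_noise1]) auto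
  finally show ?thesis .
qed

lemma partial_sum_measurable:
  assumes "j \<le> n" "l < d"
  shows "(\<lambda>x. partial_sum j x l) \<in> borel_measurable (PiM {..<n} (\<lambda>_. noise))"
proof -
  have "(\<lambda>y. y l) \<in> noise \<rightarrow>\<^sub>M noise1"
    using assms by (intro measurable_component_singleton) simp
  then have "(\<lambda>y. y l) \<in> borel_measurable noise" by simp
  moreover have "(\<lambda>x. x i) \<in> PiM {..<n} (\<lambda>_. noise) \<rightarrow>\<^sub>M noise" if "i < j" for i
    using assms that by (intro measurable_component_singleton) simp
  ultimately have "(\<lambda>x. x i l) \<in> borel_measurable (PiM {..<n} (\<lambda>_. noise))" if "i < j" for i
    using measurable_compose that by blast
  then show ?thesis
    unfolding partial_sum_def by (intro borel_measurable_sum) simp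
qed

lemma ratio_measurable:
  assumes "j \<le> n"
  shows "(\<lambda>(x, y). ratio j x y) \<in> borel_measurable (PiM {..<n} (\<lambda>_. noise) \<Otimes>\<^sub>M noise)"
proof -
  have [measurable]: "(\<lambda>p. partial_sum j (fst p) l) \<in> borel_measurable (PiM {..<n} (\<lambda>_. noise) \<Otimes>\<^sub>M noise)"
      "(\<lambda>p. snd p l) \<in> borel_measurable (PiM {..<n} (\<lambda>_. noise) \<Otimes>\<^sub>M noise)" if "l < d" for l
  proof -
    show "(\<lambda>p. partial_sum j (fst p) l) \<in> borel_measurable (PiM {..<n} (\<lambda>_. noise) \<Otimes>\<^sub>M noise)"
      by (rule measurable_compose[OF measurable_fst partial_sum_measurable[OF assms that]])
    have "(\<lambda>y. y l) \<in> noise \<rightarrow>\<^sub>M noise1"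
      using that by (intro measurable_component_singleton) simp
    then have "(\<lambda>y. y l) \<in> borel_measurable noise" by simp
    from measurable_compose[OF measurable_snd this]
    show "(\<lambda>p. snd p l) \<in> borel_measurable (PiM {..<n} (\<lambda>_. noise) \<Otimes>\<^sub>M noise)" .
  qed
  show ?thesis
    unfolding ratio_def split_beta' cosh_field_def by measurable
qed

lemma ratio_pos: "0 < ratio j x y"
  unfolding ratio_def by (intro prod_pos) simp

lemma partial_sum_past: "j \<le> i \<Longrightarrow> partial_sum j (x(i := z)) l = partial_sum j x l"
  unfolding partial_sum_def by (intro sum.cong) auto

lemma partial_sum_Suc: "partial_sum (Suc n) (x(n := y)) l = partial_sum n x l + y l"
  using partial_sum_past[of n n x y l] by (simp add: partial_sum_def)

lemma ratio_integral: "(\<integral>\<^sup>+ y. ennreal (ratio j x y) \<partial>noise) = 1"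
proof -
  have "(\<integral>\<^sup>+ y. ennreal (ratio j x y) \<partial>noise) = (\<Prod>l<d. \<integral>\<^sup>+ t. ennreal
      (exp (- \<tau> l / 2) * cosh (a l * (partial_sum j x l + t)) / cosh (a l * partial_sum j x l)) \<partial>noise1)"
    unfolding ratio_def by (intro nn_integral_noise_prod) (auto simp: cosh_field_def)
  then show ?thesis by (simp only: ratio_moment1 prod.neutral_const)
qed

lemma ratio_past: "j \<le> i \<Longrightarrow> ratio j (x(i := z)) y = ratio j x y"
  by (simp add: ratio_def partial_sum_past)

sublocale sequential_density noise ratio
  by (intro sequential_density.intro sequential_density_axioms.intro prob_space_noise ratio_measurable
      ratio_pos ratio_integral ratio_past)

end

text \<open>The first-order terms in \<open>t\<close> cancel:
  \<open>exp (- j t) \<ge> 1 - j t\<close> bounds the left side by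
  \<open>cosh t + j t sinh t\<close>, hence by \<open>1 + (1 + 2 j) t\<^sup>2\<close>. The factor
  \<open>2 * N\<close> then comes from \<open>j < N\<close>.\<close>

lemma exp_minus_sinh_le:
  fixes t :: real
  assumes t: "0 \<le> t" "t \<le> 1" and j: "j < N"
  shows "exp t - sinh t * exp (- real j * t) \<le> exp (2 * real N * t\<^sup>2)"
proof -
  have e1: "exp t \<le> 1 + t + t\<^sup>2" using t by (rule exp_bound)
  have "exp (- t) * (1 + t) \<le> exp (- t) * exp t"
    by (intro mult_left_mono exp_ge_add_one_self) simp
  also have "\<dots> = 1" by (simp flip: exp_add)
  also have "1 \<le> (1 - t + t\<^sup>2) * (1 + t)"
    using t by (simp add: algebra_simps power2_eq_square)
  finally have e2: "exp (- t) \<le> 1 - t + t\<^sup>2" using t by simp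
  have e3: "1 - t \<le> exp (- t)" using exp_ge_add_one_self[of "- t"] by simp
  have "t\<^sup>2 \<le> t" using t by (simp add: power2_eq_square mult_left_le)
  then have sinh: "sinh t \<le> 2 * t" using e1 e3 t by (simp add: sinh_field_def)
  have sinh0: "0 \<le> sinh t" using t by simp
  have "sinh t * (1 - real j * t) \<le> sinh t * exp (- real j * t)"
    using exp_ge_add_one_self[of "- real j * t"] sinh0 by (intro mult_left_mono) auto
  then have "exp t - sinh t * exp (- real j * t) \<le> cosh t + real j * t * sinh t"
    by (simp add: algebra_simps flip: cosh_plus_sinh)
  also have "\<dots> \<le> (1 + t\<^sup>2) + real j * t * (2 * t)"
    using e1 e2 sinh t by (intro add_mono mult_left_mono) (auto simp: cosh_field_def)
  also have "\<dots> = 1 + (1 + 2 * real j) * t\<^sup>2"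
    by (simp add: algebra_simps power2_eq_square)
  also have "\<dots> \<le> 1 + 2 * real N * t\<^sup>2"
    using j by (intro add_left_mono mult_right_mono) auto
  also have "\<dots> \<le> exp (2 * real N * t\<^sup>2)"
    by (rule exp_ge_add_one_self)
  finally show ?thesis .
qed

text \<open>
  Replacing \<open>1 / C\<close> by its lower bound \<open>2 p - p\<^sup>2 C\<close> makes the conditional second moment affine in
  \<open>C = cosh (\<dots>)\<close>, so that its expectation over the past is explicit.
\<close>
lemma cosh_chi_pointwise:
  fixes C s p e :: real
  assumes "0 < C" "0 \<le> s" "0 < p"
  shows "p * C * (e - s / C\<^sup>2) \<le> p * (e + s * p\<^sup>2) * C - 2 * s * p\<^sup>2"
proof -
  have "0 \<le> p * s * (1 - p * C)\<^sup>2 / C" using assms by simp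
  also have "\<dots> = p * (e + s * p\<^sup>2) * C - 2 * s * p\<^sup>2 - p * C * (e - s / C\<^sup>2)"
    using assms by (simp add: field_simps power2_eq_square)
  finally show ?thesis by simp
qed

context signed_mean
begin

text \<open>Integrating out the last sample multiplies each \<open>\<alpha> l\<close> by
  \<open>exp (\<tau> l / 2)\<close> and leaves \<beta> fixed; hence \<alpha> is generalised. The
  integral is over pure noise, so a mixture likelihood has to be absorbed into the
  coefficients.\<close>

lemma nn_integral_affine_cosh:
  assumes "\<And>l. l < d \<Longrightarrow> 0 \<le> \<beta> l" "\<And>l. l < d \<Longrightarrow> \<beta> l \<le> \<alpha> l"
  shows "(\<integral>\<^sup>+ x. ennreal (\<Prod>l<d. \<alpha> l * cosh (a l * partial_sum n x l) - \<beta> l) \<partial>Q n)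
     = ennreal (\<Prod>l<d. \<alpha> l * exp (real n * \<tau> l / 2) - \<beta> l)"
  using assms
proof (induction n arbitrary: \<alpha>)
  case 0
  then show ?case by (simp add: PiM_empty nn_integral_count_space_finite partial_sum_def)
next
  case (Suc n)
  interpret PQ: product_sigma_finite "\<lambda>_::nat. noise" by (rule product_sigma_finite_Q)
  note [measurable] = partial_sum_measurable[of "Suc n" "Suc n"]
  have meas: "(\<lambda>x. ennreal (\<Prod>l<d. \<alpha> l * cosh (a l * partial_sum (Suc n) x l) - \<beta> l))
      \<in> borel_measurable (PiM (insert n {..<n}) (\<lambda>_. noise))"
    unfolding lessThan_Suc[symmetric] cosh_field_def by measurable
  have nn: "0 \<le> \<alpha> l * c - \<beta> l" if "l < d" "1 \<le> c" for l c
    using Suc.prems[OF that(1)] mult_mono[of "\<alpha> l" "\<alpha> l" 1 c] that(2) by simp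
  have grow: "\<alpha> l \<le> \<alpha> l * exp (\<tau> l / 2)" if "l < d" for l
    using Suc.prems[OF that] tau_nonneg[of l] by (simp add: mult_le_cancel_left1)
  have "(\<integral>\<^sup>+ x. ennreal (\<Prod>l<d. \<alpha> l * cosh (a l * partial_sum (Suc n) x l) - \<beta> l) \<partial>Q (Suc n))
     = (\<integral>\<^sup>+ x. \<integral>\<^sup>+ y. ennreal (\<Prod>l<d. \<alpha> l * cosh (a l * (partial_sum n x l + y l)) - \<beta> l) \<partial>noise \<partial>Q n)"
    using PQ.product_nn_integral_insert[OF _ _ meas]
    unfolding lessThan_Suc by (simp add: partial_sum_Suc)
  also have "\<dots> = (\<integral>\<^sup>+ x. ennreal (\<Prod>l<d. (\<alpha> l * exp (\<tau> l / 2)) * cosh (a l * partial_sum n x l) - \<beta> l) \<partial>Q n)"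
  proof (intro nn_integral_cong)
    fix x
    have "(\<integral>\<^sup>+ y. ennreal (\<Prod>l<d. \<alpha> l * cosh (a l * (partial_sum n x l + y l)) - \<beta> l) \<partial>noise)
        = (\<Prod>l<d. \<integral>\<^sup>+ t. ennreal (\<alpha> l * cosh (a l * (partial_sum n x l + t)) - \<beta> l) \<partial>noise1)"
      by (intro nn_integral_noise_prod nn cosh_real_ge_1) (auto simp: cosh_field_def)
    also have "\<dots> = (\<Prod>l<d. ennreal ((\<alpha> l * exp (\<tau> l / 2)) * cosh (a l * partial_sum n x l) - \<beta> l))"
      using Suc.prems by (intro prod.cong affine_cosh_moment) auto
    also have "\<dots> = ennreal (\<Prod>l<d. (\<alpha> l * exp (\<tau> l / 2)) * cosh (a l * partial_sum n x l) - \<beta> l)"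
    proof (rule prod_ennreal)
      fix l assume "l \<in> {..<d}"
      then have "l < d" by simp
      have "1 * 1 \<le> exp (\<tau> l / 2) * cosh (a l * partial_sum n x l)"
        using tau_nonneg[of l] by (intro mult_mono cosh_real_ge_1) auto
      then show "0 \<le> (\<alpha> l * exp (\<tau> l / 2)) * cosh (a l * partial_sum n x l) - \<beta> l"
        using nn[OF \<open>l < d\<close>, of "exp (\<tau> l / 2) * cosh (a l * partial_sum n x l)"] by (simp add: mult.assoc)
    qed
    finally show "(\<integral>\<^sup>+ y. ennreal (\<Prod>l<d. \<alpha> l * cosh (a l * (partial_sum n x l + y l)) - \<beta> l) \<partial>noise)
        = ennreal (\<Prod>l<d. (\<alpha> l * exp (\<tau> l / 2)) * cosh (a l * partial_sum n x l) - \<beta> l)" .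
  qed
  also have "\<dots> = ennreal (\<Prod>l<d. (\<alpha> l * exp (\<tau> l / 2)) * exp (real n * \<tau> l / 2) - \<beta> l)"
    using Suc.prems grow by (intro Suc.IH) (auto intro: order_trans)
  also have "(\<lambda>l. (\<alpha> l * exp (\<tau> l / 2)) * exp (real n * \<tau> l / 2) - \<beta> l)
      = (\<lambda>l. \<alpha> l * exp (real (Suc n) * \<tau> l / 2) - \<beta> l)"
    by (simp add: mult.assoc field_simps flip: exp_add)
  finally show ?case .
qed

text \<open>The product telescopes: the denominator of each \<open>ratio\<close> cancels the
  \<open>cosh\<close> factor accumulated so far.\<close>

lemma lik_eq:
  "lik n x = ennreal (\<Prod>l<d. exp (- real n * \<tau> l / 2) * cosh (a l * partial_sum n x l))"
proof (induction n)
  case 0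
  show ?case by (simp add: lik_def partial_sum_def)
next
  case (Suc n)
  let ?c = "\<lambda>n l. cosh (a l * partial_sum n x l)"
  have S: "partial_sum (Suc n) x l = partial_sum n x l + x n l" for l
    by (simp add: partial_sum_def)
  have "lik (Suc n) x = lik n x * ennreal (ratio n x (x n))"
    by (simp add: lik_def)
  also have "\<dots> = ennreal ((\<Prod>l<d. exp (- real n * \<tau> l / 2) * ?c n l) * ratio n x (x n))"
    unfolding Suc.IH using ratio_pos[of n x "x n"] by (intro ennreal_mult[symmetric] prod_nonneg) auto
  also have "(\<Prod>l<d. exp (- real n * \<tau> l / 2) * ?c n l) * ratio n x (x n)
      = (\<Prod>l<d. exp (- real (Suc n) * \<tau> l / 2) * ?c (Suc n) l)"
    unfolding ratio_def prod.distrib[symmetric] S[symmetric]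
  proof (intro prod.cong refl)
    fix l
    have e: "exp (- real (Suc n) * \<tau> l / 2) = exp (- real n * \<tau> l / 2) * exp (- \<tau> l / 2)"
      by (simp add: field_simps flip: exp_add)
    show "exp (- real n * \<tau> l / 2) * ?c n l * (exp (- \<tau> l / 2) * ?c (Suc n) l / ?c n l)
        = exp (- real (Suc n) * \<tau> l / 2) * ?c (Suc n) l"
      unfolding e by simp
  qed
  finally show ?case .
qed

lemma chi_square_bound:
  "(\<integral>\<^sup>+ x. lik j x * (\<integral>\<^sup>+ y. ennreal ((ratio j x y)\<^sup>2) \<partial>noise) \<partial>Q j)
     \<le> ennreal (\<Prod>l<d. exp (\<tau> l) - sinh (\<tau> l) * exp (- real j * \<tau> l))"
proof -
  let ?C = "\<lambda>x l. cosh (a l * partial_sum j x l)"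
  \<comment> \<open>The normalising factor of \<open>lik_eq\<close>, and also the tangent parameter
    for \<open>1 / C\<close>: the noise mean of \<open>C\<close> is \<open>1 / p\<close>, so the
    affine bound touches \<open>1 / C\<close> at that mean.\<close>
  define p where "p l = exp (- real j * \<tau> l / 2)" for l
  have p: "0 < p l" "p l \<le> 1" for l
    using tau_nonneg[of l] by (auto simp: p_def mult_nonneg_nonneg)
  have p2: "(p l)\<^sup>2 = exp (- real j * \<tau> l)" for l
    by (simp add: p_def flip: exp_double)
  have s: "0 \<le> sinh (\<tau> l)" "sinh (\<tau> l) \<le> exp (\<tau> l)" for l
    using tau_nonneg[of l] cosh_real_nonneg[of "\<tau> l"] by (auto simp flip: cosh_plus_sinh)
  have nn: "0 \<le> exp (\<tau> l) - sinh (\<tau> l) / (?C x l)\<^sup>2" for x l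
  proof -
    have "1 \<le> (?C x l)\<^sup>2" by (simp add: cosh_real_ge_1)
    then have "sinh (\<tau> l) / (?C x l)\<^sup>2 \<le> sinh (\<tau> l)" using s(1)[of l]
      by (intro divide_le_eq[THEN iffD2]) (auto simp: mult_le_cancel_left1)
    then show ?thesis using s(2)[of l] by simp
  qed
  have pw: "lik j x * (\<integral>\<^sup>+ y. ennreal ((ratio j x y)\<^sup>2) \<partial>noise)
      \<le> ennreal (\<Prod>l<d. (p l * (exp (\<tau> l) + sinh (\<tau> l) * (p l)\<^sup>2)) * ?C x l - 2 * sinh (\<tau> l) * (p l)\<^sup>2)" for x
  proof -
    have "(\<integral>\<^sup>+ y. ennreal ((ratio j x y)\<^sup>2) \<partial>noise)
        = (\<Prod>l<d. \<integral>\<^sup>+ t. ennreal ((exp (- \<tau> l / 2) * cosh (a l * (partial_sum j x l + t)) / ?C x l)\<^sup>2) \<partial>noise1)"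
      unfolding ratio_def prod_power_distrib
      by (intro nn_integral_noise_prod) (auto simp: cosh_field_def)
    also have "\<dots> = (\<Prod>l<d. ennreal (exp (\<tau> l) - sinh (\<tau> l) / (?C x l)\<^sup>2))"
      by (simp only: ratio_moment2)
    also have "\<dots> = ennreal (\<Prod>l<d. exp (\<tau> l) - sinh (\<tau> l) / (?C x l)\<^sup>2)"
      by (intro prod_ennreal nn)
    finally have "lik j x * (\<integral>\<^sup>+ y. ennreal ((ratio j x y)\<^sup>2) \<partial>noise)
        = ennreal ((\<Prod>l<d. p l * ?C x l) * (\<Prod>l<d. exp (\<tau> l) - sinh (\<tau> l) / (?C x l)\<^sup>2))"
      unfolding lik_eq p_def[symmetric] using nn p(1)
      by (simp add: ennreal_mult prod_nonneg less_imp_le)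
    also have "\<dots> = ennreal (\<Prod>l<d. p l * ?C x l * (exp (\<tau> l) - sinh (\<tau> l) / (?C x l)\<^sup>2))"
      by (simp add: prod.distrib)
    also have "\<dots> \<le> ennreal (\<Prod>l<d. (p l * (exp (\<tau> l) + sinh (\<tau> l) * (p l)\<^sup>2)) * ?C x l - 2 * sinh (\<tau> l) * (p l)\<^sup>2)"
      using nn p(1) s(1)
      by (intro ennreal_leI prod_mono conjI cosh_chi_pointwise mult_nonneg_nonneg) (auto intro: less_imp_le)
    finally show ?thesis .
  qed
  have "(\<integral>\<^sup>+ x. lik j x * (\<integral>\<^sup>+ y. ennreal ((ratio j x y)\<^sup>2) \<partial>noise) \<partial>Q j)
      \<le> (\<integral>\<^sup>+ x. ennreal (\<Prod>l<d. (p l * (exp (\<tau> l) + sinh (\<tau> l) * (p l)\<^sup>2)) * ?C x l - 2 * sinh (\<tau> l) * (p l)\<^sup>2) \<partial>Q j)"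
    by (intro nn_integral_mono pw)
  also have "\<dots> = ennreal (\<Prod>l<d. (p l * (exp (\<tau> l) + sinh (\<tau> l) * (p l)\<^sup>2)) * exp (real j * \<tau> l / 2)
      - 2 * sinh (\<tau> l) * (p l)\<^sup>2)"
  proof (rule nn_integral_affine_cosh)
    fix l
    show "0 \<le> 2 * sinh (\<tau> l) * (p l)\<^sup>2" using s(1)[of l] by simp
    \<comment> \<open>As \<open>sinh\<close> is at most \<open>exp\<close>, the nonnegativity
      condition on the coefficients reduces to this square.\<close>
    have "0 \<le> sinh (\<tau> l) * (1 - p l)\<^sup>2" using s(1)[of l] by simp
    then have "0 \<le> exp (\<tau> l) + sinh (\<tau> l) * (p l)\<^sup>2 - 2 * sinh (\<tau> l) * p l"
      using s(2)[of l] by (simp add: power2_eq_square algebra_simps)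
    then have "0 \<le> p l * (exp (\<tau> l) + sinh (\<tau> l) * (p l)\<^sup>2 - 2 * sinh (\<tau> l) * p l)"
      using p(1)[of l] by simp
    then show "2 * sinh (\<tau> l) * (p l)\<^sup>2 \<le> p l * (exp (\<tau> l) + sinh (\<tau> l) * (p l)\<^sup>2)"
      by (simp add: power2_eq_square algebra_simps)
  qed
  also have "\<dots> = ennreal (\<Prod>l<d. exp (\<tau> l) - sinh (\<tau> l) * exp (- real j * \<tau> l))"
  proof -
    have "(p l * (exp (\<tau> l) + sinh (\<tau> l) * (p l)\<^sup>2)) * exp (real j * \<tau> l / 2) - 2 * sinh (\<tau> l) * (p l)\<^sup>2
        = exp (\<tau> l) - sinh (\<tau> l) * exp (- real j * \<tau> l)" for l
    proof -
      have "p l * exp (real j * \<tau> l / 2) = 1"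
        by (simp add: p_def flip: exp_add)
      then have "(p l * (exp (\<tau> l) + sinh (\<tau> l) * (p l)\<^sup>2)) * exp (real j * \<tau> l / 2)
          = exp (\<tau> l) + sinh (\<tau> l) * (p l)\<^sup>2"
        by (metis mult.commute mult.left_commute mult_1)
      then show ?thesis unfolding p2[symmetric] by linarith
    qed
    then show ?thesis by simp
  qed
  finally show ?thesis .
qed

lemma lik_excess_bound:
  assumes small: "\<And>l. l < d \<Longrightarrow> \<tau> l \<le> 1" and j: "j < N"
    and \<delta>: "0 \<le> \<delta>" "exp (2 * real N * (\<Sum>l<d. (\<tau> l)\<^sup>2)) \<le> 1 + \<delta>" and b: "0 < b"
  shows "(\<integral>\<^sup>+ x. lik j x * excess j x \<partial>Q j) \<le> ennreal (b + \<delta> / (4 * b))"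
proof (rule nn_integral_lik_excess[OF b \<delta>(1)])
  have "(\<Prod>l<d. exp (\<tau> l) - sinh (\<tau> l) * exp (- real j * \<tau> l)) \<le> (\<Prod>l<d. exp (2 * real N * (\<tau> l)\<^sup>2))"
  proof (intro prod_mono conjI exp_minus_sinh_le tau_nonneg j)
    fix l assume "l \<in> {..<d}"
    have "sinh (\<tau> l) * exp (- real j * \<tau> l) \<le> sinh (\<tau> l) * 1"
      using tau_nonneg[of l] by (intro mult_left_mono) (auto simp: mult_nonneg_nonneg)
    also have "\<dots> \<le> exp (\<tau> l)"
      using cosh_real_nonneg[of "\<tau> l"] by (simp flip: cosh_plus_sinh)
    finally show "0 \<le> exp (\<tau> l) - sinh (\<tau> l) * exp (- real j * \<tau> l)" by simp
  qed (use small in auto)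
  also have "\<dots> = exp (2 * real N * (\<Sum>l<d. (\<tau> l)\<^sup>2))"
    by (simp add: exp_sum sum_distrib_left)
  also have "\<dots> \<le> 1 + \<delta>" by (rule \<delta>(2))
  finally show "(\<integral>\<^sup>+ x. lik j x * (\<integral>\<^sup>+ y. ennreal ((ratio j x y)\<^sup>2) \<partial>noise) \<partial>Q j) \<le> ennreal (1 + \<delta>)"
    using chi_square_bound[of j] by (meson ennreal_leI order_trans)
qed


section \<open>Gaussian laws with signed means\<close>

definition signs :: "(nat \<Rightarrow> real) set" where
  "signs = PiE {..<d} (\<lambda>_. {-1, 1})"

definition mean :: "(nat \<Rightarrow> real) \<Rightarrow> real vec" where
  "mean \<eta> = vec d (\<lambda>l. \<eta> l * v l)"

lemma card_signs: "card signs = 2 ^ d"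
  by (simp add: signs_def card_PiE numeral_2_eq_2)

lemma gaussian_vec_mean:
  assumes \<eta>: "\<eta> \<in> signs"
  shows "gaussian_vec d (mean \<eta>) \<sigma> = density noise (\<lambda>y. \<Prod>l<d. ennreal (exp (\<eta> l * a l * y l - \<tau> l / 2)))"
proof -
  let ?f = "\<lambda>l t. ennreal (exp (\<eta> l * v l / \<sigma>\<^sup>2 * t - (\<eta> l * v l)\<^sup>2 / (2 * \<sigma>\<^sup>2)))"
  interpret product_sigma_finite "\<lambda>_::nat. noise1" by (rule product_sigma_finite_noise1)
  have tilt: "density noise1 (?f l) = density lborel (\<lambda>t. ennreal (normal_density (\<eta> l * v l) \<sigma> t))" for l
    by (subst density_density_eq) (simp_all flip: normal_density_tilt[OF sigma, of _ "\<eta> l * v l"] ennreal_mult)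
  have sf: "sigma_finite_measure (density noise1 (?f l))" for l
    unfolding tilt by (intro prob_space_imp_sigma_finite prob_space_normal_density sigma)
  have "gaussian_vec d (mean \<eta>) \<sigma> = PiM {..<d} (\<lambda>l. density noise1 (?f l))"
    unfolding gaussian_vec_def tilt by (intro PiM_cong) (auto simp: mean_def)
  also have "\<dots> = density noise (\<lambda>y. \<Prod>l<d. ?f l (y l))"
    by (rule PiM_density[OF _ _ sf]) auto
  also have "(\<lambda>y. \<Prod>l<d. ?f l (y l)) = (\<lambda>y. \<Prod>l<d. ennreal (exp (\<eta> l * a l * y l - \<tau> l / 2)))"
  proof (intro ext prod.cong refl)
    fix y :: "nat \<Rightarrow> real" and l assume "l \<in> {..<d}"
    then have "\<eta> l \<in> {-1, 1}" using \<eta> by (auto simp: signs_def)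
    then have "(\<eta> l * v l)\<^sup>2 = (v l)\<^sup>2" by (auto simp: power_mult_distrib)
    then show "?f l (y l) = ennreal (exp (\<eta> l * a l * y l - \<tau> l / 2))"
      by (simp add: a_def \<tau>_def)
  qed
  finally show ?thesis .
qed

lemma gaussian_vec_0: "gaussian_vec d (0\<^sub>v d) \<sigma> = noise"
  unfolding gaussian_vec_def by (intro PiM_cong) auto

lemma gaussian_sample_0: "gaussian_sample N d (0\<^sub>v d) \<sigma> = Q N"
  by (simp add: gaussian_sample_def gaussian_vec_0)

lemma prob_space_gaussian_vec: "prob_space (gaussian_vec d \<mu> \<sigma>)"
  unfolding gaussian_vec_def by (intro prob_space_PiM prob_space_normal_density sigma)

lemma gaussian_sample_mean:
  assumes \<eta>: "\<eta> \<in> signs"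
  shows "gaussian_sample N d (mean \<eta>) \<sigma>
    = density (Q N) (\<lambda>x. \<Prod>i<N. \<Prod>l<d. ennreal (exp (\<eta> l * a l * x i l - \<tau> l / 2)))"
proof -
  let ?f = "\<lambda>y. \<Prod>l<d. ennreal (exp (\<eta> l * a l * y l - \<tau> l / 2))"
  interpret product_sigma_finite "\<lambda>_::nat. noise" by (rule product_sigma_finite_Q)
  have "(\<lambda>y. y l) \<in> borel_measurable noise" if "l < d" for l
    using component[OF that, of noise1] by simp
  then have [measurable]: "?f \<in> borel_measurable noise"
    by (intro borel_measurable_prod_ennreal measurable_compose[OF _ measurable_ennreal] borel_measurable_exp
        borel_measurable_diff borel_measurable_times) auto
  have sf: "sigma_finite_measure (density noise ?f)"
    using prob_space_gaussian_vec[of "mean \<eta>"] by (simp add: gaussian_vec_mean[OF \<eta>] prob_space_imp_sigma_finite)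
  show ?thesis
    unfolding gaussian_sample_def gaussian_vec_mean[OF \<eta>]
    by (rule PiM_density[OF _ _ sf]) auto
qed

text \<open>The sum over sign vectors factorises over coordinates, each giving
  \<open>exp z + exp (- z) = 2 * cosh z\<close>. This identifies the sequentially defined
  \<open>lik\<close> as the likelihood ratio of the uniform sign mixture.\<close>

lemma average_likelihood:
  "(\<Sum>\<eta>\<in>signs. \<Prod>i<N. \<Prod>l<d. ennreal (exp (\<eta> l * a l * x i l - \<tau> l / 2))) = 2 ^ d * lik N x"
proof -
  have inner: "(\<Prod>i<N. \<Prod>l<d. ennreal (exp (\<eta> l * a l * x i l - \<tau> l / 2)))
      = ennreal (\<Prod>l<d. exp (\<eta> l * (a l * partial_sum N x l) - real N * \<tau> l / 2))" for \<eta>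
  proof -
    have "(\<Prod>i<N. \<Prod>l<d. ennreal (exp (\<eta> l * a l * x i l - \<tau> l / 2)))
        = ennreal (\<Prod>i<N. \<Prod>l<d. exp (\<eta> l * a l * x i l - \<tau> l / 2))"
      by (simp add: prod_ennreal prod_nonneg)
    also have "(\<Prod>i<N. \<Prod>l<d. exp (\<eta> l * a l * x i l - \<tau> l / 2))
        = (\<Prod>l<d. \<Prod>i<N. exp (\<eta> l * a l * x i l - \<tau> l / 2))"
      by (rule prod.swap)
    also have "\<dots> = (\<Prod>l<d. exp (\<eta> l * (a l * partial_sum N x l) - real N * \<tau> l / 2))"
      by (simp add: partial_sum_def sum_distrib_left sum_subtractf mult.assoc flip: exp_sum)
    finally show ?thesis .
  qed
  have "(\<Sum>\<eta>\<in>signs. \<Prod>l<d. exp (\<eta> l * (a l * partial_sum N x l) - real N * \<tau> l / 2))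
      = (\<Prod>l<d. \<Sum>s\<in>{-1, 1}. exp (s * (a l * partial_sum N x l) - real N * \<tau> l / 2))"
    unfolding signs_def by (subst prod_sum_PiE) auto
  also have "\<dots> = (\<Prod>l<d. 2 * (exp (- real N * \<tau> l / 2) * cosh (a l * partial_sum N x l)))"
  proof (intro prod.cong refl)
    fix l
    have "exp (- 1 * z - m) + exp (1 * z - m) = 2 * (exp (- m) * cosh z)" for z m :: real
      by (simp only: cosh_field_def diff_conv_add_uminus exp_add) (simp add: algebra_simps)
    from this[of "a l * partial_sum N x l" "real N * \<tau> l / 2"]
    show "(\<Sum>s\<in>{-1, 1}. exp (s * (a l * partial_sum N x l) - real N * \<tau> l / 2))
        = 2 * (exp (- real N * \<tau> l / 2) * cosh (a l * partial_sum N x l))"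
      by simp
  qed
  also have "\<dots> = 2 ^ d * (\<Prod>l<d. exp (- real N * \<tau> l / 2) * cosh (a l * partial_sum N x l))"
    by (simp add: prod.distrib)
  finally have sum: "(\<Sum>\<eta>\<in>signs. \<Prod>l<d. exp (\<eta> l * (a l * partial_sum N x l) - real N * \<tau> l / 2))
      = 2 ^ d * (\<Prod>l<d. exp (- real N * \<tau> l / 2) * cosh (a l * partial_sum N x l))" .
  have "(\<Sum>\<eta>\<in>signs. \<Prod>i<N. \<Prod>l<d. ennreal (exp (\<eta> l * a l * x i l - \<tau> l / 2)))
      = ennreal (\<Sum>\<eta>\<in>signs. \<Prod>l<d. exp (\<eta> l * (a l * partial_sum N x l) - real N * \<tau> l / 2))"
    unfolding inner by (intro sum_ennreal prod_nonneg) auto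
  also have "\<dots> = 2 ^ d * lik N x"
    unfolding sum lik_eq by (subst ennreal_mult) (auto intro!: prod_nonneg mult_nonneg_nonneg simp: ennreal_power[symmetric] simp del: prod.distrib)
  finally show ?thesis .
qed

section \<open>Adversary kernels and error probabilities\<close>

lemma sets_data_space: "sets (data_space N d) = sets (Q N)"
  unfolding data_space_def by (intro sets_PiM_cong refl) auto

lemma space_data_space: "space (data_space N d) = space (Q N)"
  by (rule sets_eq_imp_space_eq[OF sets_data_space])

lemma gaussian_sample_in_prob_algebra:
  "gaussian_sample N d \<mu> \<sigma> \<in> space (prob_algebra (data_space N d))"
proof -
  have "prob_space (gaussian_sample N d \<mu> \<sigma>)"
    unfolding gaussian_sample_def by (intro prob_space_PiM prob_space_gaussian_vec)
  moreover have "sets (gaussian_sample N d \<mu> \<sigma>) = sets (data_space N d)"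
    unfolding gaussian_sample_def data_space_def gaussian_vec_def
    by (intro sets_PiM_cong refl) auto
  ultimately show ?thesis
    by (simp add: space_prob_algebra)
qed

lemma test_prob_eq:
  assumes "C \<in> adversaries N d \<epsilon>" and "{x \<in> space (data_space N d). \<phi> x = b} \<in> sets (data_space N d)"
  shows "test_prob N d \<sigma> \<mu> C \<phi> b
     = (\<integral>\<^sup>+ x. emeasure (C x) {x \<in> space (data_space N d). \<phi> x = b} \<partial>gaussian_sample N d \<mu> \<sigma>)"
  unfolding test_prob_def using assms
  by (intro emeasure_bind_prob_algebra[OF gaussian_sample_in_prob_algebra]) (auto simp: adversaries_def)

lemma singleton_in_sets_PiM:
  assumes "finite I" "y \<in> space (PiM I M)" "\<And>i. i \<in> I \<Longrightarrow> {y i} \<in> sets (M i)"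
  shows "{y} \<in> sets (PiM I M)"
proof -
  have "PiE I (\<lambda>i. {y i}) \<in> sets (PiM I M)"
    using assms by (intro sets_PiM_I_finite) auto
  also have "PiE I (\<lambda>i. {y i}) = {y}"
    using assms(2) by (intro PiE_singleton) (auto simp: space_PiM PiE_def)
  finally show ?thesis .
qed

lemma singleton_in_sets_noise: "y \<in> space noise \<Longrightarrow> {y} \<in> sets noise"
  by (rule singleton_in_sets_PiM) auto

lemma singleton_in_sets_data_space:
  assumes "x \<in> space (data_space N d)"
  shows "{x} \<in> sets (data_space N d)"
  unfolding sets_data_space using assms
  by (intro singleton_in_sets_PiM singleton_in_sets_noise) (auto simp: space_data_space space_PiM[of "{..<N}"])

lemma strategy_in_adversaries:
  assumes "0 \<le> \<epsilon>"
  shows "strategy N (\<epsilon> * real N) \<in> adversaries N d \<epsilon>"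
proof -
  have "strategy N (\<epsilon> * real N) \<in> data_space N d \<rightarrow>\<^sub>M prob_algebra (data_space N d)"
  proof -
    \<comment> \<open>The two spaces carry different measures but the same measurable sets, and
      \<open>prob_algebra\<close> depends on nothing else.\<close>
    have "prob_algebra (data_space N d) = prob_algebra (Q N)"
      unfolding prob_algebra_def subprob_algebra_cong[OF sets_data_space] ..
    then show ?thesis
      using strategy_measurable[of N "\<epsilon> * real N"]
        measurable_cong_sets[OF sets_data_space refl, of N "prob_algebra (Q N)"] by simp
  qed
  moreover have "AE y in strategy N (\<epsilon> * real N) x. real (card {i\<in>{..<N}. y i \<noteq> x i}) \<le> \<epsilon> * real N"
    if "x \<in> space (data_space N d)" for x
    using that assms by (intro strategy_budget singleton_in_sets_noise) (auto simp: space_data_space)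
  ultimately show ?thesis
    by (simp add: adversaries_def)
qed

text \<open>The idle adversary transfers the level constraint, which concerns all adversaries, to
  clean noise.\<close>

lemma test_prob_return:
  assumes meas: "{x \<in> space (data_space N d). \<phi> x = b} \<in> sets (data_space N d)" and \<epsilon>: "0 \<le> \<epsilon>"
  shows "return (data_space N d) \<in> adversaries N d \<epsilon>"
    and "test_prob N d \<sigma> \<mu> (return (data_space N d)) \<phi> b
      = emeasure (gaussian_sample N d \<mu> \<sigma>) {x \<in> space (data_space N d). \<phi> x = b}"
proof -
  have "AE y in return (data_space N d) x. real (card {i\<in>{..<N}. y i \<noteq> x i}) \<le> \<epsilon> * real N"
    if "x \<in> space (data_space N d)" for x
  proof -
    have "AE y in return (data_space N d) x. y = x"
    proof (subst AE_return)
      have "{y \<in> space (data_space N d). y = x} = {x}" using that by auto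
      then show "Measurable.pred (data_space N d) (\<lambda>y. y = x)"
        using singleton_in_sets_data_space[OF that] by (simp add: pred_def)
    qed (use that in auto)
    then show ?thesis by eventually_elim (simp add: \<epsilon>)
  qed
  then show ret: "return (data_space N d) \<in> adversaries N d \<epsilon>"
    by (simp add: adversaries_def measurable_return_prob_space)
  have "sets (gaussian_sample N d \<mu> \<sigma>) = sets (data_space N d)"
    using gaussian_sample_in_prob_algebra by (simp add: space_prob_algebra)
  then show "test_prob N d \<sigma> \<mu> (return (data_space N d)) \<phi> b
      = emeasure (gaussian_sample N d \<mu> \<sigma>) {x \<in> space (data_space N d). \<phi> x = b}"
    unfolding test_prob_eq[OF ret meas] using meas
    by simp
qed

text \<open>The strategy does not depend on \<eta>, so averaging the bound \<open>B\<close> over the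
  signs yields the integral against \<open>lik N\<close>, which \<open>strategy_simulates\<close>
  compares with pure noise. The error term is the expected number of replacements, at most
  \<open>N * (k + \<delta> / (4 * k))\<close>, over the budget
  \<open>\<epsilon> * N\<close>.\<close>

lemma sign_mixture_bound:
  assumes N: "0 < N" and \<epsilon>: "0 < \<epsilon>" and meas: "{x \<in> space (data_space N d). \<phi> x = b} \<in> sets (data_space N d)"
    and small: "\<And>l. l < d \<Longrightarrow> \<tau> l \<le> 1"
    and \<delta>: "0 \<le> \<delta>" "exp (2 * real N * (\<Sum>l<d. (\<tau> l)\<^sup>2)) \<le> 1 + \<delta>" and k: "0 < k"
    and B: "\<And>\<eta>. \<eta> \<in> signs \<Longrightarrow> test_prob N d \<sigma> (mean \<eta>) (strategy N (\<epsilon> * real N)) \<phi> b \<le> B"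
  shows "emeasure (gaussian_sample N d (0\<^sub>v d) \<sigma>) {x \<in> space (data_space N d). \<phi> x = b}
     \<le> B + ennreal ((k + \<delta> / (4 * k)) / \<epsilon>)"
proof -
  define A where "A = {x \<in> space (data_space N d). \<phi> x = b}"
  define h where "h x = emeasure (strategy N (\<epsilon> * real N) x) A" for x
  define f where "f \<eta> x = (\<Prod>i<N. \<Prod>l<d. ennreal (exp (\<eta> l * a l * x i l - \<tau> l / 2)))"
    for \<eta> :: "nat \<Rightarrow> real" and x :: "nat \<Rightarrow> nat \<Rightarrow> real"
  have sum_f: "(\<Sum>\<eta>\<in>signs. f \<eta> x) = 2 ^ d * lik N x" for x
    unfolding f_def by (rule average_likelihood)
  have A [measurable]: "A \<in> sets (Q N)"
    using meas by (simp add: A_def sets_data_space)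
  have sm: "strategy N (\<epsilon> * real N) \<in> Q N \<rightarrow>\<^sub>M subprob_algebra (Q N)"
    by (rule measurable_prob_algebraD[OF strategy_measurable])
  have h [measurable]: "h \<in> borel_measurable (Q N)"
    unfolding h_def using emeasure_measurable_subprob_algebra2[OF _ sm, of "\<lambda>_. A"] by simp
  have f [measurable]: "f \<eta> \<in> borel_measurable (Q N)" for \<eta>
  proof -
    have "(\<lambda>x. x i l) \<in> borel_measurable (Q N)" if "i < N" "l < d" for i l
      using measurable_compose[OF component[OF that(1), of noise] component[OF that(2), of noise1]] by simp
    then show ?thesis
      unfolding f_def
      by (intro borel_measurable_prod_ennreal measurable_compose[OF _ measurable_ennreal] borel_measurable_exp
        borel_measurable_diff borel_measurable_times) auto
  qed
  have "2 ^ d * (\<integral>\<^sup>+ x. lik N x * h x \<partial>Q N) = (\<integral>\<^sup>+ x. (\<Sum>\<eta>\<in>signs. f \<eta> x) * h x \<partial>Q N)"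
    unfolding sum_f mult.assoc
    by (intro nn_integral_cmult[symmetric] borel_measurable_times_ennreal lik_measurable h) simp
  also have "\<dots> = (\<Sum>\<eta>\<in>signs. \<integral>\<^sup>+ x. f \<eta> x * h x \<partial>Q N)"
    unfolding sum_distrib_right by (intro nn_integral_sum) measurable
  also have "\<dots> \<le> (\<Sum>\<eta>\<in>signs. B)"
  proof (intro sum_mono)
    fix \<eta> assume \<eta>: "\<eta> \<in> signs"
    have "(\<integral>\<^sup>+ x. f \<eta> x * h x \<partial>Q N) = (\<integral>\<^sup>+ x. h x \<partial>gaussian_sample N d (mean \<eta>) \<sigma>)"
      unfolding gaussian_sample_mean[OF \<eta>] f_def[symmetric]
      by (rule nn_integral_density[symmetric]) measurable
    also have "\<dots> = test_prob N d \<sigma> (mean \<eta>) (strategy N (\<epsilon> * real N)) \<phi> b"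
      unfolding h_def A_def using \<epsilon>
      by (intro test_prob_eq[OF strategy_in_adversaries meas, symmetric]) simp
    finally show "(\<integral>\<^sup>+ x. f \<eta> x * h x \<partial>Q N) \<le> B"
      using B[OF \<eta>] by simp
  qed
  also have "\<dots> = 2 ^ d * B"
    by (simp add: card_signs)
  finally have le: "(\<integral>\<^sup>+ x. lik N x * h x \<partial>Q N) \<le> B"
    by (subst (asm) ennreal_mult_le_mult_iff) (auto simp: power_eq_top_ennreal)
  have "emeasure (Q N) A \<le> (\<integral>\<^sup>+ x. lik N x * h x \<partial>Q N)
      + ennreal (1 / (\<epsilon> * real N)) * (\<Sum>m<N. \<integral>\<^sup>+ x. lik m x * excess m x \<partial>Q m)"
    unfolding h_def using \<epsilon> N by (intro strategy_simulates A) simp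
  also have "\<dots> \<le> B + ennreal (1 / (\<epsilon> * real N)) * (\<Sum>m<N. ennreal (k + \<delta> / (4 * k)))"
    by (intro add_mono le mult_left_mono sum_mono lik_excess_bound[OF small _ \<delta> k]) auto
  also have "(\<Sum>m<N. ennreal (k + \<delta> / (4 * k))) = ennreal (real N * (k + \<delta> / (4 * k)))"
    using k \<delta>(1) by (subst sum_ennreal) auto
  also have "ennreal (1 / (\<epsilon> * real N)) * \<dots> = ennreal ((k + \<delta> / (4 * k)) / \<epsilon>)"
    using k \<delta>(1) \<epsilon> N by (subst ennreal_mult[symmetric]) auto
  finally show ?thesis
    by (simp add: gaussian_sample_0 A_def)
qed

end

section \<open>The lower bound\<close>

lemma kolmogorov_width_empty: "kolmogorov_width d {} 0 = 0"
proof -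
  \<comment> \<open>Without a projection of rank 0 the infimum would be infinite rather than
    0.\<close>
  have "orth_projections d 0 \<noteq> {}"
    using coord_proj_in_orth_projections[of "{}" d] by auto
  then show ?thesis by (simp add: kolmogorov_width_def bot_ennreal)
qed

lemma zero_in_QCO:
  assumes "QCO d K" "K \<noteq> {}"
  shows "0\<^sub>v d \<in> K"
proof -
  obtain \<theta> where "\<theta> \<in> K" using assms by auto
  then have "vec d (\<lambda>i. 0 * \<theta> $ i) \<in> K"
    using assms by (intro QCO_shrink) auto
  then show ?thesis by (simp add: zero_vec_def)
qed

text \<open>The index 0 always qualifies, since the width at -1 is infinite; the maximum is thus
  over a nonempty set and satisfies the defining inequality.\<close>

lemma k2_star_width:
  assumes "k2_star d K \<sigma> N \<epsilon> = k"
  shows "k \<le> d" "kolmogorov_width d K (int k - 1) > ennreal (real k powr (1/4) * sqrt \<epsilon> / real N powr (1/4) * \<sigma>)"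
proof -
  let ?J = "{j \<in> {0..d}. kolmogorov_width d K (int j - 1)
            > ennreal (real j powr (1/4) * sqrt \<epsilon> / real N powr (1/4) * \<sigma>)}"
  have "0 \<in> ?J" by (simp add: kolmogorov_width_def ennreal_less_top)
  then have "Max ?J \<in> ?J" by (intro Max_in) auto
  then show "k \<le> d" "kolmogorov_width d K (int k - 1) > ennreal (real k powr (1/4) * sqrt \<epsilon> / real N powr (1/4) * \<sigma>)"
    using assms by (auto simp: k2_star_def)
qed

theorem theorem3p5:
  shows "\<exists>c::real. c > 0 \<and>
    (\<forall>(d::nat) (N::nat) (\<sigma>::real) (\<epsilon>::real) (\<rho>::real) (K::real vec set).
       d \<ge> 1 \<longrightarrow> N \<ge> 1 \<longrightarrow> \<sigma> > 0 \<longrightarrow> 0 \<le> \<epsilon> \<longrightarrow> \<epsilon> < 1/2 \<longrightarrow>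
       QCO d K \<longrightarrow>
       kolmogorov_width d K 0 > ennreal (\<sigma> / sqrt (real N)) \<longrightarrow>
       \<rho> \<le> c * (real (k2_star d K \<sigma> N \<epsilon>) powr (1/4) * sqrt \<epsilon> * \<sigma> / real N powr (1/4)) \<longrightarrow>
       (INF \<phi> \<in> level_tests N d \<sigma> \<epsilon> (1/10).
          SUP \<mu> \<in> {\<mu>\<in>K. vnorm \<mu> \<ge> \<rho>}.
            SUP C \<in> adversaries N d \<epsilon>. test_prob N d \<sigma> \<mu> C \<phi> 0) \<ge> ennreal (1/10))"
proof (intro exI[of _ "1 / 5 :: real"] conjI allI impI INF_greatest)
  fix d N :: nat and \<sigma> \<epsilon> \<rho> :: real and K :: "real vec set" and \<phi> :: "(nat \<Rightarrow> nat \<Rightarrow> real) \<Rightarrow> nat"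
  assume d: "1 \<le> d" and N: "1 \<le> N" and \<sigma>: "0 < \<sigma>" and \<epsilon>: "0 \<le> \<epsilon>" "\<epsilon> < 1/2" and K: "QCO d K"
    and width0: "kolmogorov_width d K 0 > ennreal (\<sigma> / sqrt (real N))"
    and \<rho>: "\<rho> \<le> 1 / 5 * (real (k2_star d K \<sigma> N \<epsilon>) powr (1/4) * sqrt \<epsilon> * \<sigma> / real N powr (1/4))"
    and \<phi>: "\<phi> \<in> level_tests N d \<sigma> \<epsilon> (1 / 10)"
  define V where "V = (SUP \<mu> \<in> {\<mu>\<in>K. vnorm \<mu> \<ge> \<rho>}. SUP C \<in> adversaries N d \<epsilon>. test_prob N d \<sigma> \<mu> C \<phi> 0)"
  define A where "A b = {x \<in> space (data_space N d). \<phi> x = b}" for b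
  define G where "G = gaussian_sample N d (0\<^sub>v d) \<sigma>"
  have ne: "K \<noteq> {}" using width0 kolmogorov_width_empty by auto
  have meas: "A b \<in> sets (data_space N d)" if "b \<in> {0, 1}" for b
  proof -
    have "\<phi> -` {b} \<inter> space (data_space N d) \<in> sets (data_space N d)"
      using \<phi> that by (intro measurable_sets[of \<phi> _ "count_space {0, 1}"]) (auto simp: level_tests_def)
    then show ?thesis by (simp add: A_def vimage_def Int_def conj_commute)
  qed
  then have meas0: "A 0 \<in> sets (data_space N d)" and meas1: "A 1 \<in> sets (data_space N d)"
    by auto
  have V_upper: "test_prob N d \<sigma> \<mu> C \<phi> 0 \<le> V" if "\<mu> \<in> K" "\<rho> \<le> vnorm \<mu>" "C \<in> adversaries N d \<epsilon>" for \<mu> C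
    unfolding V_def using that
    by (intro SUP_upper2[of \<mu>]) (auto intro: SUP_upper)
  have null: "ennreal (9 / 10) \<le> emeasure G (A 0)"
  proof -
    \<comment> \<open>The zero shift is a placeholder: only facts about Gaussian laws and kernels
      are taken from the locale.\<close>
    interpret signed_mean d \<sigma> "\<lambda>_. 0" by unfold_locales (rule \<sigma>)
    note ret = test_prob_return[OF meas1[unfolded A_def] \<epsilon>(1)]
    have "emeasure G (A 1) = test_prob N d \<sigma> (0\<^sub>v d) (return (data_space N d)) \<phi> 1"
      unfolding G_def A_def by (rule ret(2)[symmetric])
    also have "\<dots> \<le> (SUP C\<in>adversaries N d \<epsilon>. test_prob N d \<sigma> (0\<^sub>v d) C \<phi> 1)"
      using ret(1) by (rule SUP_upper)
    also have "\<dots> \<le> ennreal (1 / 10)"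
      using \<phi> by (simp add: level_tests_def)
    finally have le: "emeasure G (A 1) \<le> ennreal (1 / 10)" .
    interpret G: prob_space G
      using gaussian_sample_in_prob_algebra[of N "0\<^sub>v d"] by (simp add: G_def space_prob_algebra)
    have setsG: "sets G = sets (data_space N d)"
      using gaussian_sample_in_prob_algebra[of N "0\<^sub>v d"] by (simp add: G_def space_prob_algebra)
    have "\<phi> x \<in> {0, 1}" if "x \<in> space (data_space N d)" for x
      using \<phi> that by (auto simp: level_tests_def dest: measurable_space)
    then have "A 0 \<union> A 1 = space G" "A 0 \<inter> A 1 = {}"
      using sets_eq_imp_space_eq[OF setsG] by (auto simp: A_def)
    then have "G.prob (A 0) + G.prob (A 1) = 1"
      using meas0 meas1 setsG by (subst G.finite_measure_Union[symmetric]) (auto simp: G.prob_space)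
    moreover have "G.prob (A 1) \<le> 1 / 10"
      using le by (simp add: G.emeasure_eq_measure)
    ultimately show ?thesis
      unfolding G.emeasure_eq_measure by (intro ennreal_leI) linarith
  qed
  show "ennreal (1 / 10) \<le> V"
  \<comment> \<open>If \<open>\<rho> \<le> 0\<close>, the zero mean is itself an alternative. This
    also disposes of \<open>k = 0\<close> and \<open>\<epsilon> = 0\<close>, where the assumed bound
    forces \<open>\<rho> \<le> 0\<close>.\<close>
  proof (cases "\<rho> \<le> 0")
    case True
    interpret signed_mean d \<sigma> "\<lambda>_. 0" by unfold_locales (rule \<sigma>)
    note ret = test_prob_return[OF meas0[unfolded A_def] \<epsilon>(1)]
    have "ennreal (1 / 10) \<le> ennreal (9 / 10)"
      by (intro ennreal_leI) simp
    also have "\<dots> \<le> emeasure G (A 0)" by (rule null)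
    also have "\<dots> = test_prob N d \<sigma> (0\<^sub>v d) (return (data_space N d)) \<phi> 0"
      unfolding G_def A_def by (rule ret(2)[symmetric])
    also have "\<dots> \<le> V"
      using True ret(1) zero_in_QCO[OF K ne] by (intro V_upper) (auto simp: vnorm_def intro: order_trans)
    finally show ?thesis .
  next
    case False
    define k where "k = k2_star d K \<sigma> N \<epsilon>"
    define r where "r = real k powr (1/4) * sqrt \<epsilon> / real N powr (1/4) * \<sigma>"
    have k: "k \<le> d" and width: "kolmogorov_width d K (int k - 1) > ennreal r"
      using k2_star_width[OF k_def[symmetric]] by (simp_all add: r_def)
    have \<rho>r: "\<rho> \<le> 1 / 5 * r"
      using \<rho> by (simp add: r_def k_def field_simps)
    then have r: "0 < r" using False by simp
    have "k = 0 \<Longrightarrow> r = 0" "\<epsilon> = 0 \<Longrightarrow> r = 0" by (simp_all add: r_def)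
    then have "k \<noteq> 0" "\<epsilon> \<noteq> 0" using r by auto
    then have k1: "1 \<le> k" and \<epsilon>0: "0 < \<epsilon>"
      using \<epsilon>(1) by auto
    have r2: "r\<^sup>2 = sqrt k * \<epsilon> / sqrt N * \<sigma>\<^sup>2"
    proof -
      have "(x powr (1/4))\<^sup>2 = sqrt x" if "0 < x" for x :: real
        using that by (simp add: powr_half_sqrt power2_eq_square flip: powr_add)
      then show ?thesis
        using k1 N \<epsilon>0 by (simp add: r_def power_mult_distrib power_divide)
    qed
    obtain v where v: "v \<in> K" "(\<Sum>i<d. (v $ i)\<^sup>2) = (1 / 5 * r)\<^sup>2"
        "\<And>i. i < d \<Longrightarrow> (v $ i)\<^sup>2 \<le> 12 * (1 / 5)\<^sup>2 * r\<^sup>2 / k"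
      using QCO_spread[OF K ne k1 k r width, of "1 / 5"] by auto
    interpret signed_mean d \<sigma> "\<lambda>l. v $ l" by unfold_locales (rule \<sigma>)
    have mean_K: "mean \<eta> \<in> K" if "\<eta> \<in> signs" for \<eta>
      unfolding mean_def
    proof (rule QCO_shrink[OF K v(1)])
      fix i assume "i < d"
      then have "\<eta> i \<in> {-1, 1}" using that by (auto simp: signs_def)
      then show "\<bar>\<eta> i\<bar> \<le> 1" by auto
    qed
    have mean_norm: "vnorm (mean \<eta>) = 1 / 5 * r" if "\<eta> \<in> signs" for \<eta>
    proof -
      have "(mean \<eta> $ i)\<^sup>2 = (v $ i)\<^sup>2" if "i < d" for i
      proof -
        have "\<eta> i \<in> {-1, 1}" using \<open>\<eta> \<in> signs\<close> that by (auto simp: signs_def)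
        then show ?thesis using that by (auto simp: mean_def power_mult_distrib)
      qed
      then have "(\<Sum>i<d. (mean \<eta> $ i)\<^sup>2) = (1 / 5 * r)\<^sup>2"
        using v(2) by simp
      then show ?thesis
        using r by (simp add: vnorm_def L2_set_def mean_def)
    qed
    define t where "t = 12 / 25 * \<epsilon> / (sqrt k * sqrt N)"
    have tau_le: "\<tau> l \<le> t" if "l < d" for l
    proof -
      have "\<tau> l \<le> (12 * (1 / 5)\<^sup>2 * r\<^sup>2 / k) / \<sigma>\<^sup>2"
        unfolding \<tau>_def using v(3)[OF that] by (intro divide_right_mono) auto
      also have "\<dots> = 12 / 25 * \<epsilon> * (sqrt k / k) / sqrt N"
        unfolding r2 using \<sigma> by (simp add: power2_eq_square mult_ac)
      also have "sqrt k / k = 1 / sqrt k"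
        using k1 by (simp add: divide_simps)
      finally show ?thesis by (simp add: t_def)
    qed
    have t1: "t \<le> 1"
    proof -
      have "1 * 1 \<le> sqrt k * sqrt N" using k1 N by (intro mult_mono) auto
      then show ?thesis using \<epsilon> by (simp add: t_def divide_simps)
    qed
    \<comment> \<open>One factor \<open>\<tau> l\<close> is bounded by \<open>t\<close>, the other
      is summed through the norm of \<open>v\<close>; the dependence on \<open>k\<close> then
      cancels.\<close>
    have "(\<Sum>l<d. (\<tau> l)\<^sup>2) \<le> (\<Sum>l<d. t * \<tau> l)"
      unfolding power2_eq_square using tau_le tau_nonneg by (intro sum_mono mult_right_mono) auto
    also have "\<dots> = t * ((1 / 5 * r)\<^sup>2 / \<sigma>\<^sup>2)"
      unfolding v(2)[symmetric] \<tau>_def by (simp add: sum_distrib_left sum_divide_distrib)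
    also have "\<dots> = t * (sqrt k * \<epsilon> / (25 * sqrt N))"
      unfolding power_mult_distrib r2 using \<sigma> by (simp add: power2_eq_square mult_ac)
    also have "\<dots> = 12 / 625 * \<epsilon>\<^sup>2 / N"
    proof -
      have "sqrt N * sqrt N = N" by simp
      then have "t * (sqrt k * \<epsilon> / (25 * sqrt N)) = 12 / 625 * (\<epsilon> * \<epsilon>) * (sqrt k / sqrt k) / (sqrt N * sqrt N)"
        unfolding t_def by (simp add: field_simps)
      then show ?thesis using k1 by (simp add: power2_eq_square)
    qed
    finally have "2 * real N * (\<Sum>l<d. (\<tau> l)\<^sup>2) \<le> 2 * real N * (12 / 625 * \<epsilon>\<^sup>2 / N)"
      by (intro mult_left_mono) auto
    then have "2 * real N * (\<Sum>l<d. (\<tau> l)\<^sup>2) \<le> 24 / 625 * \<epsilon>\<^sup>2"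
      using N by simp
    then have "exp (2 * real N * (\<Sum>l<d. (\<tau> l)\<^sup>2)) \<le> exp (24 / 625 * \<epsilon>\<^sup>2)" by simp
    also have "\<dots> \<le> 1 + 48 / 625 * \<epsilon>\<^sup>2"
    proof -
      have "\<epsilon>\<^sup>2 \<le> 1" using \<epsilon> by (simp add: power_le_one)
      then have x: "0 \<le> 24 / 625 * \<epsilon>\<^sup>2" "24 / 625 * \<epsilon>\<^sup>2 \<le> 1" by auto
      have "(24 / 625 * \<epsilon>\<^sup>2)\<^sup>2 \<le> 24 / 625 * \<epsilon>\<^sup>2"
        using x mult_left_le[OF x(2) x(1)] by (simp add: power2_eq_square)
      then show ?thesis using exp_bound[OF x] by linarith
    qed
    finally have chi: "exp (2 * real N * (\<Sum>l<d. (\<tau> l)\<^sup>2)) \<le> 1 + 48 / 625 * \<epsilon>\<^sup>2" .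
    \<comment> \<open>With AM-GM parameter \<open>\<epsilon> / 25\<close> the expected fraction of
      the budget used is at most \<open>1/25 + 12/25 = 13/25\<close>; anything up to
      \<open>9/10 - 1/10\<close> would suffice.\<close>
    have "emeasure G (A 0) \<le> V + ennreal ((\<epsilon> / 25 + (48 / 625 * \<epsilon>\<^sup>2) / (4 * (\<epsilon> / 25))) / \<epsilon>)"
      unfolding G_def A_def
    proof (rule sign_mixture_bound[OF _ \<epsilon>0 meas0[unfolded A_def] _ _ chi])
      show "test_prob N d \<sigma> (mean \<eta>) (strategy N (\<epsilon> * real N)) \<phi> 0 \<le> V" if "\<eta> \<in> signs" for \<eta>
        using mean_K[OF that] mean_norm[OF that] \<rho>r strategy_in_adversaries[OF \<epsilon>(1)]
        by (intro V_upper) auto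
      show "\<tau> l \<le> 1" if "l < d" for l using tau_le[OF that] t1 by simp
    qed (use N \<epsilon>0 in auto)
    also have "(\<epsilon> / 25 + (48 / 625 * \<epsilon>\<^sup>2) / (4 * (\<epsilon> / 25))) / \<epsilon> = 13 / 25"
      using \<epsilon>0 by (simp add: field_simps power2_eq_square)
    finally have le: "ennreal (9 / 10) \<le> V + ennreal (13 / 25)"
      using null by order
    show ?thesis
    proof (cases V)
      case (real x)
      then have "ennreal (9 / 10) \<le> ennreal (x + 13 / 25)"
        using le by (subst ennreal_plus) auto
      then have "9 / 10 \<le> x + 13 / 25"
        using real by (subst (asm) ennreal_le_iff) auto
      then have "1 / 10 \<le> x" by simp
      then show ?thesis using real by (simp add: ennreal_leI)
    qed simp
  qed
qed simp

end
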